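(* Let $\mathcal{G}$ be a branching simple stochastic game with a target type, and let $T_i$ be a starting type from which the value of the game of not reaching the target is $0$. Then the player minimizing the probability of not reaching the target type has a deterministic (non-static) optimal strategy, i.e., a deterministic strategy $\tau$ such that, starting from a single object of type $T_i$, for every strategy $\sigma$ of the opponent the probability of never reaching an object of the target type is $0$.
   Context: A BSSG consists of types $T_1,\dots,T_n$ partitioned between two players, each type with a finite nonempty action set and, for each action, a finite set of rules $T_i\xrightarrow{p_r}\alpha_r$ ($\alpha_r\in\mathbb{N}^n$ a multiset of types, rational $p_r>0$ summing to 1). From an initial population, in each generation each player chooses actions for the objects of its types, then rules are chosen independently at random and each object is replaced by its offspring. Strategies may depend on the full history (all past generations, actions, rules and parent–child relations) and may be randomized; deterministic strategies never randomize, and static strategies use the same action for all objects of a type at all times. One player wants to maximize, the other to minimize, the probability that no object of the target type is ever produced; the value from $T_i$ is $\sup_\sigma\inf_\tau$ of this probability (which equals $\inf_\tau\sup_\sigma$). *)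

theory Defs
  imports "HOL-Probability.Probability" "HOL-Library.Finite_Map"
begin

text \<open>The names refer to the payoff, the probability of \<^emph>\<open>not\<close> reaching the target type.\<close>
datatype player = MaxPlayer | MinPlayer

text \<open>A rule of a pair (type, action) consists of its probability and its offspring vector.\<close>
type_synonym 't rule = "rat \<times> ('t \<Rightarrow> nat)"

record ('t, 'a) bssg =
  owner :: "'t \<Rightarrow> player"
  actions :: "'t \<Rightarrow> 'a set"
  rules :: "'t \<Rightarrow> 'a \<Rightarrow> 't rule set"

definition bssg :: "('t::finite, 'a) bssg \<Rightarrow> bool" where
  "bssg G \<longleftrightarrow>
     (\<forall>T. finite (actions G T) \<and> actions G T \<noteq> {}) \<and>
     (\<forall>T. \<forall>a\<in>actions G T.
        finite (rules G T a) \<and> (\<forall>r\<in>rules G T a. 0 < fst r) \<and> (\<Sum>r\<in>rules G T a. fst r) = 1)"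

text \<open>
  An object is identified by its line of descent, youngest first: \<open>(T, j) # x\<close> is the \<open>j\<close>-th
  child of type \<open>T\<close> of the object \<open>x\<close>, and \<open>[(T, j)]\<close> is the \<open>j\<close>-th object of type \<open>T\<close> of the
  initial population.  The parent-child relation is therefore part of the object.
\<close>
type_synonym 't obj = "('t \<times> nat) list"

definition obj_type :: "'t obj \<Rightarrow> 't" where
  "obj_type x = fst (hd x)"

text \<open>One generation: the action and the rule used at each of its objects.\<close>
type_synonym ('t, 'a) step = "('t obj, 'a \<times> 't rule) fmap"

text \<open>
  A history consists of the initial population and the list of all past generations, oldest first;
  this is a forest whose internal nodes are labelled with an action and a rule and whose leaves are
  the current population.
\<close>
type_synonym ('t, 'a) history = "('t \<Rightarrow> nat) \<times> ('t, 'a) step list"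

definition roots :: "('t \<Rightarrow> nat) \<Rightarrow> 't obj set" where
  "roots \<mu> = {[(T, j)] | T j. j < \<mu> T}"

definition offspring :: "('t, 'a) step \<Rightarrow> 't obj set" where
  "offspring s = {(T, j) # x | T j x a p \<alpha>. fmlookup s x = Some (a, (p, \<alpha>)) \<and> j < \<alpha> T}"

definition population :: "('t, 'a) history \<Rightarrow> 't obj set" where
  "population h = (if snd h = [] then roots (fst h) else offspring (last (snd h)))"

inductive_set histories :: "('t, 'a) bssg \<Rightarrow> ('t, 'a) history set" for G where
  init: "(\<mu>, []) \<in> histories G"
| step: "(\<mu>, ss) \<in> histories G \<Longrightarrow> fmdom' s = population (\<mu>, ss) \<Longrightarrow>
     (\<And>x a r. fmlookup s x = Some (a, r) \<Longrightarrow>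
        a \<in> actions G (obj_type x) \<and> r \<in> rules G (obj_type x) a) \<Longrightarrow>
     (\<mu>, ss @ [s]) \<in> histories G"

text \<open>The tuples of actions that a player can choose for its objects in the current population.\<close>
definition joint_actions ::
    "('t, 'a) bssg \<Rightarrow> player \<Rightarrow> ('t, 'a) history \<Rightarrow> ('t obj, 'a) fmap set" where
  "joint_actions G P h =
     {c. fmdom' c = {x \<in> population h. owner G (obj_type x) = P} \<and>
         (\<forall>x a. fmlookup c x = Some a \<longrightarrow> a \<in> actions G (obj_type x))}"

type_synonym ('t, 'a) strategy = "('t, 'a) history \<Rightarrow> ('t obj, 'a) fmap pmf"

definition strategies :: "('t, 'a) bssg \<Rightarrow> player \<Rightarrow> ('t, 'a) strategy set" where
  "strategies G P = {\<sigma>. \<forall>h\<in>histories G. set_pmf (\<sigma> h) \<subseteq> joint_actions G P h}"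

definition deterministic :: "('t, 'a) bssg \<Rightarrow> ('t, 'a) strategy \<Rightarrow> bool" where
  "deterministic G \<sigma> \<longleftrightarrow> (\<forall>h\<in>histories G. \<exists>c. \<sigma> h = return_pmf c)"

definition rule_pmf :: "('t, 'a) bssg \<Rightarrow> 't \<Rightarrow> 'a \<Rightarrow> 't rule pmf" where
  "rule_pmf G T a = embed_pmf (\<lambda>r. if r \<in> rules G T a then real_of_rat (fst r) else 0)"

text \<open>
  The distribution of the next generation: the players draw their action tuples independently of
  each other, and then each object independently draws a rule of its type and action.
\<close>
definition step_pmf :: "('t, 'a) bssg \<Rightarrow> ('t, 'a) strategy \<Rightarrow> ('t, 'a) strategy \<Rightarrow>
    ('t, 'a) history \<Rightarrow> ('t, 'a) step pmf" where
  "step_pmf G \<sigma> \<tau> h =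
     bind_pmf (\<sigma> h) (\<lambda>c. bind_pmf (\<tau> h) (\<lambda>d.
       map_pmf (\<lambda>\<rho>. fmmap_keys (\<lambda>x a. (a, \<rho> x)) (c ++\<^sub>f d))
         (Pi_pmf (fmdom' (c ++\<^sub>f d)) undefined
           (\<lambda>x. rule_pmf G (obj_type x) (the (fmlookup (c ++\<^sub>f d) x))))))"

definition play_kernel :: "('t, 'a) bssg \<Rightarrow> ('t, 'a) strategy \<Rightarrow> ('t, 'a) strategy \<Rightarrow>
    ('t \<Rightarrow> nat) \<Rightarrow> nat \<Rightarrow> (nat \<Rightarrow> ('t, 'a) step) \<Rightarrow> ('t, 'a) step measure" where
  "play_kernel G \<sigma> \<tau> \<mu> k \<omega> = measure_pmf (step_pmf G \<sigma> \<tau> (\<mu>, map \<omega> [0..<k]))"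

text \<open>
  Infinite plays are distributed according to the Ionescu-Tulcea extension of the kernels.
  Countability of the actions makes the type of generations countable, so that every kernel is
  measurable.  A play that becomes extinct continues with empty generations.
\<close>
lemma Ionescu_Tulcea_play_kernel:
  fixes G :: "('t::finite, 'a::countable) bssg"
  shows "Ionescu_Tulcea (play_kernel G \<sigma> \<tau> \<mu>) (\<lambda>_. count_space UNIV)"
proof (rule Ionescu_Tulcea.intro)
  fix k :: nat
  have "PiM {0..<k} (\<lambda>_. count_space (UNIV :: ('t, 'a) step set)) =
      count_space (PiE {0..<k} (\<lambda>_. UNIV))"
    by (rule count_space_PiM_finite) auto
  moreover have "play_kernel G \<sigma> \<tau> \<mu> k \<omega> \<in> space (subprob_algebra (count_space UNIV))" for \<omega>
    by (simp add: play_kernel_def space_subprob_algebra measure_pmf.subprob_space_axioms)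
  ultimately show "play_kernel G \<sigma> \<tau> \<mu> k \<in>
      measurable (PiM {0..<k} (\<lambda>_. count_space UNIV)) (subprob_algebra (count_space UNIV))"
    by simp
next
  fix k :: nat and \<omega> :: "nat \<Rightarrow> ('t, 'a) step"
  show "prob_space (play_kernel G \<sigma> \<tau> \<mu> k \<omega>)"
    by (simp add: play_kernel_def measure_pmf.prob_space_axioms)
qed

definition play_measure :: "('t::finite, 'a::countable) bssg \<Rightarrow> ('t, 'a) strategy \<Rightarrow>
    ('t, 'a) strategy \<Rightarrow> ('t \<Rightarrow> nat) \<Rightarrow> (nat \<Rightarrow> ('t, 'a) step) measure" where
  "play_measure G \<sigma> \<tau> \<mu> =
     projective_family.lim UNIV
       (Ionescu_Tulcea.CI (play_kernel G \<sigma> \<tau> \<mu>) (\<lambda>_. count_space UNIV))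
       (\<lambda>_. count_space UNIV)"

lemma prob_space_play_measure: "prob_space (play_measure G \<sigma> \<tau> \<mu>)"
proof -
  interpret Ionescu_Tulcea "play_kernel G \<sigma> \<tau> \<mu>" "\<lambda>_. count_space UNIV"
    by (rule Ionescu_Tulcea_play_kernel)
  have "prob_space (distr PF.lim (PiM {} (\<lambda>_. count_space UNIV)) (\<lambda>x. restrict x {}))"
    by (subst distr_lim) (auto intro: PF.prob_space_P)
  moreover have "(\<lambda>x. restrict x {}) \<in> measurable PF.lim (PiM {} (\<lambda>_. count_space UNIV))"
    by (simp add: measurable_cong_sets[OF PF.sets_lim refl] measurable_restrict)
  ultimately show ?thesis
    unfolding play_measure_def by (rule prob_space_distrD[rotated])
qed

definition avoids :: "'t \<Rightarrow> ('t \<Rightarrow> nat) \<Rightarrow> (nat \<Rightarrow> ('t, 'a) step) \<Rightarrow> bool" where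
  "avoids target \<mu> \<omega> \<longleftrightarrow> (\<forall>k. \<forall>x\<in>population (\<mu>, map \<omega> [0..<k]). obj_type x \<noteq> target)"

lemma sets_avoids: "{\<omega>. avoids target \<mu> \<omega>} \<in> sets (play_measure G \<sigma> \<tau> \<mu>)"
proof -
  interpret Ionescu_Tulcea "play_kernel G \<sigma> \<tau> \<mu>" "\<lambda>_. count_space UNIV"
    by (rule Ionescu_Tulcea_play_kernel)
  let ?M = "PiM UNIV (\<lambda>_. count_space UNIV) :: (nat \<Rightarrow> ('a, 'b) step) measure"
  have coord [measurable]: "(\<lambda>\<omega>. \<omega> k) \<in> measurable ?M (count_space UNIV)" for k
    by (rule measurable_component_singleton) simp
  have [measurable]: "(\<lambda>\<omega>. map \<omega> [0..<k]) \<in> measurable ?M (count_space UNIV)" for k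
  proof (induction k)
    case (Suc k)
    have "(\<lambda>\<omega>. map \<omega> [0..<k] @ [\<omega> k]) \<in> measurable ?M (count_space UNIV)"
      using Suc by measurable
    then show ?case by simp
  qed simp
  have "{\<omega> \<in> space ?M. avoids target \<mu> \<omega>} \<in> sets ?M"
    unfolding avoids_def by measurable
  then show ?thesis
    by (simp add: play_measure_def space_PiM)
qed

definition nonreach_prob :: "('t::finite, 'a::countable) bssg \<Rightarrow> 't \<Rightarrow> ('t \<Rightarrow> nat) \<Rightarrow>
    ('t, 'a) strategy \<Rightarrow> ('t, 'a) strategy \<Rightarrow> real" where
  "nonreach_prob G target \<mu> \<sigma> \<tau> = measure (play_measure G \<sigma> \<tau> \<mu>) {\<omega>. avoids target \<mu> \<omega>}"

definition singleton_pop :: "'t \<Rightarrow> 't \<Rightarrow> nat" where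
  "singleton_pop T = (\<lambda>T'. if T' = T then 1 else 0)"

definition nonreach_value :: "('t::finite, 'a::countable) bssg \<Rightarrow> 't \<Rightarrow> 't \<Rightarrow> real" where
  "nonreach_value G target T =
     (SUP \<sigma>\<in>strategies G MaxPlayer. INF \<tau>\<in>strategies G MinPlayer.
        nonreach_prob G target (singleton_pop T) \<sigma> \<tau>)"

end

theory Submission
  imports Defs
begin

text \<open>
  Let \<open>g\<close> be the greatest vector \<open>v\<close> with \<open>v \<le> P v\<close>, where \<open>P\<close> is the min-max operator whose
  components are the expected products of \<open>v\<close> over the offspring.  If the maximizer plays statically
  an action that is optimal for \<open>g\<close>, then the product of \<open>g\<close> over the population is a submartingale,
  so the value is at least \<open>g\<close>; hence value \<open>0\<close> implies \<open>g T = 0\<close>.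

  Let \<open>D\<close> be the set of types from which the minimizer can force a positive probability of reaching
  the target.  Outside \<open>D\<close> we have \<open>g = 1\<close>.  From a type in \<open>F = {g = 0}\<close> the minimizer can always
  keep one \<^emph>\<open>main\<close> object inside \<open>F\<close>, and can moreover do so such that within boundedly many
  generations, with positive probability, the line of main objects hits the target or has a sibling
  in \<open>D\<close>: raising \<open>g\<close> by a small constant on the types where this fails would give a larger vector
  with \<open>v \<le> P v\<close>.  The strategy lets the main object follow these actions and every other object
  play statically towards the target inside \<open>D\<close>.  From every history, the target is then reached
  within a fixed number of generations with probability bounded away from \<open>0\<close>, and a geometric bound
  gives non-reachability probability \<open>0\<close>.
\<close>

subsection \<open>Finite-horizon avoidance probabilities\<close>

definition extend_history :: "('t, 'a) history \<Rightarrow> ('t, 'a) step \<Rightarrow> ('t, 'a) history" where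
  "extend_history h s = (fst h, snd h @ [s])"

definition safe :: "'t \<Rightarrow> ('t, 'a) history \<Rightarrow> bool" where
  "safe target h \<longleftrightarrow> (\<forall>x\<in>population h. obj_type x \<noteq> target)"

primrec avoid_prob :: "('t, 'a) bssg \<Rightarrow> 't \<Rightarrow> ('t, 'a) strategy \<Rightarrow> ('t, 'a) strategy \<Rightarrow>
    nat \<Rightarrow> ('t, 'a) history \<Rightarrow> real" where
  "avoid_prob G target \<sigma> \<tau> 0 h = of_bool (safe target h)"
| "avoid_prob G target \<sigma> \<tau> (Suc k) h = of_bool (safe target h) *
     measure_pmf.expectation (step_pmf G \<sigma> \<tau> h) (\<lambda>s. avoid_prob G target \<sigma> \<tau> k (extend_history h s))"

lemma integrable_measure_pmf_bounded:
  fixes f :: "'b \<Rightarrow> real"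
  assumes "\<And>x. x \<in> set_pmf p \<Longrightarrow> \<bar>f x\<bar> \<le> B"
  shows "integrable (measure_pmf p) f"
  by (rule measure_pmf.integrable_const_bound[where B = B]) (auto simp: AE_measure_pmf_iff assms)

lemma expectation_pmf_mono:
  fixes f g :: "'b \<Rightarrow> real"
  assumes "\<And>x. x \<in> set_pmf p \<Longrightarrow> 0 \<le> f x" "\<And>x. x \<in> set_pmf p \<Longrightarrow> f x \<le> g x"
    and "\<And>x. x \<in> set_pmf p \<Longrightarrow> g x \<le> B"
  shows "measure_pmf.expectation p f \<le> measure_pmf.expectation p g"
proof (rule integral_mono_AE)
  show "integrable (measure_pmf p) f" "integrable (measure_pmf p) g"
    using assms by (force intro!: integrable_measure_pmf_bounded[where B = B])+
qed (auto simp: AE_measure_pmf_iff assms)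

lemma expectation_pmf_le_const:
  fixes f :: "'b \<Rightarrow> real"
  assumes "\<And>x. x \<in> set_pmf p \<Longrightarrow> 0 \<le> f x" "\<And>x. x \<in> set_pmf p \<Longrightarrow> f x \<le> B"
  shows "measure_pmf.expectation p f \<le> B"
  using expectation_pmf_mono[of p f "\<lambda>_. B" B] assms by simp

lemma expectation_pmf_ge_const:
  fixes f :: "'b \<Rightarrow> real"
  assumes "0 \<le> c" "\<And>x. x \<in> set_pmf p \<Longrightarrow> c \<le> f x" "\<And>x. x \<in> set_pmf p \<Longrightarrow> f x \<le> B"
  shows "c \<le> measure_pmf.expectation p f"
  using expectation_pmf_mono[of p "\<lambda>_. c" f B] assms by simp

lemma expectation_bind_pmf_bounded:
  fixes f :: "'b \<Rightarrow> real"
  assumes "\<And>x. \<bar>f x\<bar> \<le> B"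
  shows "measure_pmf.expectation (bind_pmf p q) f =
    measure_pmf.expectation p (\<lambda>x. measure_pmf.expectation (q x) f)"
  unfolding measure_pmf_bind
  by (rule integral_bind[where K = "count_space UNIV" and B' = 1 and B = B])
    (auto simp: assms measure_pmf.emeasure_space_1 measure_pmf.subprob_space_axioms
      space_subprob_algebra)

lemma avoid_prob_bounds: "0 \<le> avoid_prob G target \<sigma> \<tau> k h" "avoid_prob G target \<sigma> \<tau> k h \<le> 1"
proof -
  have "0 \<le> avoid_prob G target \<sigma> \<tau> k h \<and> avoid_prob G target \<sigma> \<tau> k h \<le> 1"
  proof (induction k arbitrary: h)
    case (Suc k)
    show ?case
      using Suc expectation_pmf_le_const[where p = "step_pmf G \<sigma> \<tau> h" and B = 1]
      by (auto intro!: integral_nonneg_AE)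
  qed auto
  then show "0 \<le> avoid_prob G target \<sigma> \<tau> k h" "avoid_prob G target \<sigma> \<tau> k h \<le> 1" by auto
qed

lemma avoid_prob_unsafe: "\<not> safe target h \<Longrightarrow> avoid_prob G target \<sigma> \<tau> k h = 0"
  by (cases k) auto

lemma avoid_prob_antimono:
  assumes "j \<le> k"
  shows "avoid_prob G target \<sigma> \<tau> k h \<le> avoid_prob G target \<sigma> \<tau> j h"
proof -
  have "avoid_prob G target \<sigma> \<tau> (Suc k) h \<le> avoid_prob G target \<sigma> \<tau> k h" for k h
  proof (induction k arbitrary: h)
    case 0
    show ?case
      using expectation_pmf_le_const[where p = "step_pmf G \<sigma> \<tau> h" and B = 1] by auto
  next
    case (Suc k)
    show ?case
      unfolding avoid_prob.simps(2)[of _ _ _ _ "Suc k"] avoid_prob.simps(2)[of _ _ _ _ k h]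
      by (intro mult_left_mono expectation_pmf_mono[where B = 1] Suc avoid_prob_bounds) auto
  qed
  with assms show ?thesis
    by (rule lift_Suc_antimono_le[rotated])
qed

primrec generations :: "('t, 'a) bssg \<Rightarrow> ('t, 'a) strategy \<Rightarrow> ('t, 'a) strategy \<Rightarrow>
    ('t \<Rightarrow> nat) \<Rightarrow> nat \<Rightarrow> ('t, 'a) step list pmf" where
  "generations G \<sigma> \<tau> \<mu> 0 = return_pmf []"
| "generations G \<sigma> \<tau> \<mu> (Suc k) = bind_pmf (generations G \<sigma> \<tau> \<mu> k)
     (\<lambda>ss. map_pmf (\<lambda>s. ss @ [s]) (step_pmf G \<sigma> \<tau> (\<mu>, ss)))"

lemma length_generations: "ss \<in> set_pmf (generations G \<sigma> \<tau> \<mu> k) \<Longrightarrow> length ss = k"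
  by (induction k arbitrary: ss) auto

lemma prob_generations_safe:
  "measure_pmf.prob (generations G \<sigma> \<tau> \<mu> k) {ss. \<forall>i\<le>k. safe target (\<mu>, take i ss)} =
    avoid_prob G target \<sigma> \<tau> k (\<mu>, [])"
proof -
  define Q where "Q j k = measure_pmf.expectation (generations G \<sigma> \<tau> \<mu> j)
    (\<lambda>ss. of_bool (\<forall>i<j. safe target (\<mu>, take i ss)) * avoid_prob G target \<sigma> \<tau> k (\<mu>, ss))" for j k
  have shift: "Q j (Suc k) = Q (Suc j) k" for j k
  proof -
    have bound: "\<bar>of_bool (\<forall>i<Suc j. safe target (\<mu>, take i ss)) *
        avoid_prob G target \<sigma> \<tau> k (\<mu>, ss)\<bar> \<le> 1" for ss
      using avoid_prob_bounds[of G target \<sigma> \<tau> k "(\<mu>, ss)"] by auto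
    show ?thesis
      unfolding Q_def generations.simps
      by (subst expectation_bind_pmf_bounded[OF bound], auto intro!: integral_cong_AE
          dest!: length_generations simp: AE_measure_pmf_iff less_Suc_eq all_conj_distrib extend_history_def,
          blast)
  qed
  have "Q j k = Q 0 (j + k)" for j k
    by (induction j arbitrary: k) (simp_all add: shift[symmetric])
  from this[of k 0] have "Q k 0 = avoid_prob G target \<sigma> \<tau> k (\<mu>, [])"
    by (simp add: Q_def)
  moreover have "Q k 0 = measure_pmf.expectation (generations G \<sigma> \<tau> \<mu> k)
      (\<lambda>ss. indicator {ss. \<forall>i\<le>k. safe target (\<mu>, take i ss)} ss)"
    unfolding Q_def
  proof (rule integral_cong_AE)
    show "AE ss in measure_pmf (generations G \<sigma> \<tau> \<mu> k).
        of_bool (\<forall>i<k. safe target (\<mu>, take i ss)) * avoid_prob G target \<sigma> \<tau> 0 (\<mu>, ss) =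
        indicator {ss. \<forall>i\<le>k. safe target (\<mu>, take i ss)} ss"
      by (auto dest!: length_generations
          simp: AE_measure_pmf_iff le_less all_conj_distrib indicator_def)
  qed auto
  ultimately show ?thesis by simp
qed

lemma
  fixes G :: "('t::finite, 'a::countable) bssg"
  shows sets_play_prefix: "{\<omega>. map \<omega> [0..<k] \<in> A} \<in> sets (play_measure G \<sigma> \<tau> \<mu>)"
    and emeasure_play_prefix: "emeasure (play_measure G \<sigma> \<tau> \<mu>) {\<omega>. map \<omega> [0..<k] \<in> A} =
      emeasure (measure_pmf (generations G \<sigma> \<tau> \<mu> k)) A"
proof -
  let ?M = "\<lambda>_::nat. count_space (UNIV :: ('t, 'a) step set)"
  interpret Ionescu_Tulcea "play_kernel G \<sigma> \<tau> \<mu>" ?M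
    by (rule Ionescu_Tulcea_play_kernel)
  have PiM_eq: "PiM {0..<n} ?M = count_space (PiE {0..<n} (\<lambda>_. UNIV))" for n
    by (rule count_space_PiM_finite) auto
  have u: "(\<lambda>_. undefined) \<in> space (PiM {0..<0} ?M)"
    by (simp add: space_PiM)
  have C_eq: "(\<integral>\<^sup>+ x. f (map x [0..<m]) \<partial>C 0 m (\<lambda>_. undefined)) =
      (\<integral>\<^sup>+ ss. f ss \<partial>measure_pmf (generations G \<sigma> \<tau> \<mu> m))" for m and f :: "_ \<Rightarrow> ennreal"
  proof (induction m arbitrary: f)
    case 0
    show ?case
      using u by (simp add: nn_integral_return)
  next
    case (Suc m)
    have "(\<integral>\<^sup>+ x. f (map x [0..<Suc m]) \<partial>C 0 (Suc m) (\<lambda>_. undefined)) =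
        (\<integral>\<^sup>+ x. \<integral>\<^sup>+ y. f (map y [0..<Suc m]) \<partial>eP m x \<partial>C 0 m (\<lambda>_. undefined))"
      unfolding C.simps add_0
      apply (rule nn_integral_bind[where B = "PiM {0..<Suc m} ?M"])
      subgoal by (simp add: PiM_eq)
      subgoal using measurable_eP[of m] sets_C[OF u, of m] by (simp cong: measurable_cong_sets)
      done
    also have "\<dots> = (\<integral>\<^sup>+ x. \<integral>\<^sup>+ s. f (map x [0..<m] @ [s])
        \<partial>measure_pmf (step_pmf G \<sigma> \<tau> (\<mu>, map x [0..<m])) \<partial>C 0 m (\<lambda>_. undefined))"
    proof (rule nn_integral_cong)
      fix x assume "x \<in> space (C 0 m (\<lambda>_. undefined))"
      then have x: "x \<in> space (PiM {0..<m} ?M)"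
        using space_C[OF u, of m] by simp
      have "(\<integral>\<^sup>+ y. f (map y [0..<Suc m]) \<partial>eP m x) =
          (\<integral>\<^sup>+ s. f (map (x(m := s)) [0..<Suc m]) \<partial>play_kernel G \<sigma> \<tau> \<mu> m x)"
        by (rule nn_integral_eP[OF x]) (simp add: PiM_eq)
      then show "(\<integral>\<^sup>+ y. f (map y [0..<Suc m]) \<partial>eP m x) = (\<integral>\<^sup>+ s. f (map x [0..<m] @ [s])
        \<partial>measure_pmf (step_pmf G \<sigma> \<tau> (\<mu>, map x [0..<m])))"
        by (simp add: play_kernel_def)
    qed
    also have "\<dots> = (\<integral>\<^sup>+ ss. f ss \<partial>measure_pmf (generations G \<sigma> \<tau> \<mu> (Suc m)))"
      by (subst Suc.IH[of "\<lambda>ss. \<integral>\<^sup>+ s. f (ss @ [s]) \<partial>measure_pmf (step_pmf G \<sigma> \<tau> (\<mu>, ss))"]) simp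
    finally show ?case .
  qed
  let ?X = "{x \<in> PiE {0..<k} (\<lambda>_. UNIV). map x [0..<k] \<in> A}"
  have X: "?X \<in> sets (PiM {0..<k} ?M)"
    by (simp add: PiM_eq)
  have emb: "{\<omega>. map \<omega> [0..<k] \<in> A} = prod_emb UNIV ?M {0..<k} ?X"
  proof -
    have *: "map (restrict \<omega> {0..<k}) [0..<k] = map \<omega> [0..<k]" for \<omega> :: "nat \<Rightarrow> ('t, 'a) step"
      by simp
    show ?thesis
      by (auto simp: * prod_emb_def space_PiM simp del: restrict_apply)
  qed
  show "{\<omega>. map \<omega> [0..<k] \<in> A} \<in> sets (play_measure G \<sigma> \<tau> \<mu>)"
    unfolding emb play_measure_def PF.sets_lim by (rule measurable_prod_emb[OF subset_UNIV X])
  have "emeasure (play_measure G \<sigma> \<tau> \<mu>) {\<omega>. map \<omega> [0..<k] \<in> A} = emeasure (CI {0..<k}) ?X"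
    unfolding play_measure_def emb using lim[OF _ X] by simp
  also have "\<dots> = emeasure (C 0 k (\<lambda>_. undefined)) (prod_emb {0..<k} ?M {0..<k} ?X)"
    by (rule emeasure_CI[OF _ X]) simp
  also have "prod_emb {0..<k} ?M {0..<k} ?X = ?X"
    using sets.sets_into_space[OF X] by (subst prod_emb_id) (auto simp: space_PiM)
  also have "emeasure (C 0 k (\<lambda>_. undefined)) ?X =
      (\<integral>\<^sup>+ x. indicator ?X x \<partial>C 0 k (\<lambda>_. undefined))"
    using X sets_C[OF u, of k] by (subst nn_integral_indicator) auto
  also have "\<dots> = (\<integral>\<^sup>+ x. indicator A (map x [0..<k]) \<partial>C 0 k (\<lambda>_. undefined))"
    using space_C[OF u, of k]
    by (intro nn_integral_cong) (auto simp: indicator_def space_PiM)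
  also have "\<dots> = emeasure (measure_pmf (generations G \<sigma> \<tau> \<mu> k)) A"
    by (subst C_eq) simp
  finally show "emeasure (play_measure G \<sigma> \<tau> \<mu>) {\<omega>. map \<omega> [0..<k] \<in> A} =
    emeasure (measure_pmf (generations G \<sigma> \<tau> \<mu> k)) A" .
qed

lemma nonreach_prob_limit:
  fixes G :: "('t::finite, 'a::countable) bssg"
  shows "(\<lambda>k. avoid_prob G target \<sigma> \<tau> k (\<mu>, [])) \<longlonglongrightarrow> nonreach_prob G target \<mu> \<sigma> \<tau>"
proof -
  interpret prob_space "play_measure G \<sigma> \<tau> \<mu>"
    by (rule prob_space_play_measure)
  define A where "A k = {\<omega> :: nat \<Rightarrow> ('t, 'a) step.
    map \<omega> [0..<k] \<in> {ss. \<forall>i\<le>k. safe target (\<mu>, take i ss)}}" for k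
  have A_eq: "A k = {\<omega>. \<forall>i\<le>k. safe target (\<mu>, map \<omega> [0..<i])}" for k
    by (auto simp: A_def take_map min_def)
  have prob_A: "prob (A k) = avoid_prob G target \<sigma> \<tau> k (\<mu>, [])" for k
    using emeasure_play_prefix[of G \<sigma> \<tau> \<mu> k "{ss. \<forall>i\<le>k. safe target (\<mu>, take i ss)}"]
    by (simp only: A_def measure_def prob_generations_safe[symmetric])
  have "A k \<in> events" for k
    unfolding A_def by (rule sets_play_prefix)
  moreover have "decseq A"
    by (auto simp: decseq_def A_eq)
  ultimately have "(\<lambda>k. prob (A k)) \<longlonglongrightarrow> prob (\<Inter>k. A k)"
    by (intro finite_Lim_measure_decseq) auto
  moreover have "(\<Inter>k. A k) = {\<omega>. avoids target \<mu> \<omega>}"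
    by (auto simp: A_eq avoids_def safe_def)
  ultimately show ?thesis
    by (simp add: prob_A nonreach_prob_def)
qed

subsection \<open>One generation\<close>

lemma bssgD:
  assumes "bssg G"
  shows "finite (actions G T)" "\<exists>a. a \<in> actions G T"
    and "a \<in> actions G T \<Longrightarrow> finite (rules G T a)"
    and "a \<in> actions G T \<Longrightarrow> r \<in> rules G T a \<Longrightarrow> 0 < fst r"
    and "a \<in> actions G T \<Longrightarrow> (\<Sum>r\<in>rules G T a. fst r) = 1"
  using assms unfolding bssg_def by blast+

lemma pmf_rule_pmf:
  assumes "bssg G" "a \<in> actions G T"
  shows "pmf (rule_pmf G T a) r = (if r \<in> rules G T a then real_of_rat (fst r) else 0)"
proof -
  have fin: "finite (rules G T a)" and pos: "\<And>r. r \<in> rules G T a \<Longrightarrow> 0 < fst r"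
    and sum1: "(\<Sum>r\<in>rules G T a. fst r) = 1"
    using assms by (auto simp: bssg_def)
  have "(\<integral>\<^sup>+ r. ennreal (if r \<in> rules G T a then real_of_rat (fst r) else 0) \<partial>count_space UNIV) =
      (\<Sum>r\<in>rules G T a. ennreal (real_of_rat (fst r)))"
    by (subst nn_integral_count_space'[OF fin]) auto
  also have "\<dots> = ennreal (\<Sum>r\<in>rules G T a. real_of_rat (fst r))"
    using pos by (intro sum_ennreal) (simp add: less_imp_le)
  also have "(\<Sum>r\<in>rules G T a. real_of_rat (fst r)) = 1"
    using sum1 by (simp flip: of_rat_sum)
  finally show ?thesis
    unfolding rule_pmf_def using pos by (subst pmf_embed_pmf) (auto simp: less_imp_le)
qed

lemma set_rule_pmf:
  assumes "bssg G" "a \<in> actions G T"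
  shows "set_pmf (rule_pmf G T a) = rules G T a"
  using assms by (force simp: set_pmf_eq pmf_rule_pmf bssg_def)

definition offspring_value :: "('t::finite, 'a) bssg \<Rightarrow> ('t \<Rightarrow> real) \<Rightarrow> 't \<Rightarrow> 'a \<Rightarrow> real" where
  "offspring_value G v T a =
     (\<Sum>r\<in>rules G T a. real_of_rat (fst r) * (\<Prod>T'\<in>UNIV. v T' ^ snd r T'))"

lemma expectation_rule_pmf:
  assumes "bssg G" "a \<in> actions G T"
  shows "measure_pmf.expectation (rule_pmf G T a) (\<lambda>r. \<Prod>T'\<in>UNIV. v T' ^ snd r T') =
    offspring_value G v T a"
  using assms
  by (subst integral_measure_pmf[of "rules G T a"])
    (auto simp: set_rule_pmf pmf_rule_pmf offspring_value_def bssg_def intro!: sum.cong)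

lemma finite_roots: "finite (roots (\<mu> :: 't::finite \<Rightarrow> nat))"
proof -
  have "roots \<mu> = (\<lambda>(T, j). [(T, j)]) ` (SIGMA T:UNIV. {..<\<mu> T})"
    by (auto simp: roots_def)
  then show ?thesis by simp
qed

lemma offspring_eq_image:
  "offspring s = (\<lambda>(x, T, j). (T, j) # x) `
     (SIGMA x:fmdom' s. SIGMA T:UNIV. {..<snd (snd (the (fmlookup s x))) T})"
  by (force simp: offspring_def fmlookup_dom'_iff image_iff)

lemma finite_population: "finite (population (h :: ('t::finite, 'a) history))"
  by (simp add: population_def finite_roots offspring_eq_image)

lemma prod_offspring:
  fixes s :: "('t::finite, 'a) step" and w :: "'t \<Rightarrow> real"
  shows "(\<Prod>y\<in>offspring s. w (obj_type y)) =
    (\<Prod>x\<in>fmdom' s. \<Prod>T\<in>UNIV. w T ^ snd (snd (the (fmlookup s x))) T)"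
proof -
  have "(\<Prod>y\<in>offspring s. w (obj_type y)) =
      (\<Prod>(x, T, j)\<in>(SIGMA x:fmdom' s. SIGMA T:UNIV. {..<snd (snd (the (fmlookup s x))) T}). w T)"
    unfolding offspring_eq_image
    by (subst prod.reindex) (auto simp: inj_on_def obj_type_def intro!: prod.cong)
  also have "\<dots> = (\<Prod>x\<in>fmdom' s. \<Prod>(T, j)\<in>(SIGMA T:UNIV. {..<snd (snd (the (fmlookup s x))) T}). w T)"
    by (subst prod.Sigma) (auto simp: case_prod_beta)
  also have "\<dots> = (\<Prod>x\<in>fmdom' s. \<Prod>T\<in>UNIV. w T ^ snd (snd (the (fmlookup s x))) T)"
    by (intro prod.cong refl, subst prod.Sigma[symmetric]) auto
  finally show ?thesis .
qed

lemma population_extend [simp]: "population (extend_history h s) = offspring s"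
  by (simp add: extend_history_def population_def)

definition outcome_pmf :: "('t, 'a) bssg \<Rightarrow> ('t obj, 'a) fmap \<Rightarrow> ('t, 'a) step pmf" where
  "outcome_pmf G m = map_pmf (\<lambda>\<rho>. fmmap_keys (\<lambda>x a. (a, \<rho> x)) m)
     (Pi_pmf (fmdom' m) undefined (\<lambda>x. rule_pmf G (obj_type x) (the (fmlookup m x))))"

lemma step_pmf_eq:
  "step_pmf G \<sigma> \<tau> h = bind_pmf (\<sigma> h) (\<lambda>c. bind_pmf (\<tau> h) (\<lambda>d. outcome_pmf G (c ++\<^sub>f d)))"
  by (simp add: step_pmf_def outcome_pmf_def)

definition legal_choices :: "('t, 'a) strategy \<Rightarrow> ('t, 'a) strategy \<Rightarrow> ('t, 'a) history \<Rightarrow>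
    ('t obj, 'a) fmap set" where
  "legal_choices \<sigma> \<tau> h = {c ++\<^sub>f d | c d. c \<in> set_pmf (\<sigma> h) \<and> d \<in> set_pmf (\<tau> h)}"

lemma legal_choices_lookup:
  assumes "\<sigma> \<in> strategies G MaxPlayer" "\<tau> \<in> strategies G MinPlayer" "h \<in> histories G"
    and "m \<in> legal_choices \<sigma> \<tau> h"
  shows "fmdom' m = population h"
    and "x \<in> population h \<Longrightarrow> \<exists>a\<in>actions G (obj_type x). fmlookup m x = Some a"
proof -
  obtain c d where m: "m = c ++\<^sub>f d" "c \<in> joint_actions G MaxPlayer h" "d \<in> joint_actions G MinPlayer h"
    using assms by (force simp: legal_choices_def strategies_def)
  have "owner G (obj_type x) = MaxPlayer \<or> owner G (obj_type x) = MinPlayer" for x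
    by (cases "owner G (obj_type x)") auto
  with m show dom: "fmdom' m = population h"
    by (auto simp: joint_actions_def)
  assume "x \<in> population h"
  with dom obtain a where a: "fmlookup m x = Some a"
    by (metis fmlookup_dom'_iff)
  with m have "fmlookup c x = Some a \<or> fmlookup d x = Some a"
    by (auto split: if_splits)
  with m have "a \<in> actions G (obj_type x)"
    by (auto simp: joint_actions_def)
  with a show "\<exists>a\<in>actions G (obj_type x). fmlookup m x = Some a" by auto
qed

lemma set_step_pmf:
  "set_pmf (step_pmf G \<sigma> \<tau> h) = (\<Union>m\<in>legal_choices \<sigma> \<tau> h. set_pmf (outcome_pmf G m))"
  by (auto simp: step_pmf_eq legal_choices_def)

lemma set_outcome_pmf:
  assumes "s \<in> set_pmf (outcome_pmf G m)"
    and "bssg G" "\<And>x a. fmlookup m x = Some a \<Longrightarrow> a \<in> actions G (obj_type x)"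
  shows "fmdom' s = fmdom' m"
    and "fmlookup m x = Some a \<Longrightarrow> \<exists>r\<in>rules G (obj_type x) a. fmlookup s x = Some (a, r)"
proof -
  obtain \<rho> where \<rho>: "s = fmmap_keys (\<lambda>x a. (a, \<rho> x)) m"
    "\<And>x. x \<in> fmdom' m \<Longrightarrow> \<rho> x \<in> set_pmf (rule_pmf G (obj_type x) (the (fmlookup m x)))"
    using assms(1) by (auto simp: outcome_pmf_def set_Pi_pmf PiE_dflt_def)
  show "fmdom' s = fmdom' m"
    by (auto simp: \<rho>(1) fmlookup_dom'_iff)
  assume a: "fmlookup m x = Some a"
  then have "\<rho> x \<in> rules G (obj_type x) a"
    using \<rho>(2)[of x] assms(2) assms(3)[OF a] by (auto simp: fmlookup_dom'_iff set_rule_pmf)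
  with a show "\<exists>r\<in>rules G (obj_type x) a. fmlookup s x = Some (a, r)"
    by (auto simp: \<rho>(1))
qed

lemma step_lookup:
  assumes "bssg G" "\<sigma> \<in> strategies G MaxPlayer" "\<tau> \<in> strategies G MinPlayer" "h \<in> histories G"
    and "s \<in> set_pmf (step_pmf G \<sigma> \<tau> h)"
  obtains m where "m \<in> legal_choices \<sigma> \<tau> h" "fmdom' s = population h"
    "\<And>x. x \<in> population h \<Longrightarrow> \<exists>a\<in>actions G (obj_type x). \<exists>r\<in>rules G (obj_type x) a.
       fmlookup m x = Some a \<and> fmlookup s x = Some (a, r)"
proof -
  obtain m where m: "m \<in> legal_choices \<sigma> \<tau> h" "s \<in> set_pmf (outcome_pmf G m)"
    using assms(5) by (auto simp: set_step_pmf)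
  note lk = legal_choices_lookup[OF assms(2-4) m(1)]
  have act: "a \<in> actions G (obj_type x)" if "fmlookup m x = Some a" for x a
    using lk(2)[of x] that lk(1) by (force simp: fmlookup_dom'_iff)
  have "fmdom' s = population h"
    using set_outcome_pmf(1)[OF m(2) assms(1) act] lk(1) by simp
  moreover have "\<exists>a\<in>actions G (obj_type x). \<exists>r\<in>rules G (obj_type x) a.
       fmlookup m x = Some a \<and> fmlookup s x = Some (a, r)" if "x \<in> population h" for x
    using set_outcome_pmf(2)[OF m(2) assms(1) act] lk(2)[OF that] by blast
  ultimately show ?thesis
    using m(1) that by blast
qed

lemma extend_histories:
  assumes "bssg G" "\<sigma> \<in> strategies G MaxPlayer" "\<tau> \<in> strategies G MinPlayer" "h \<in> histories G"
    and "s \<in> set_pmf (step_pmf G \<sigma> \<tau> h)"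
  shows "extend_history h s \<in> histories G"
proof -
  obtain m where m: "fmdom' s = population h"
    "\<And>x. x \<in> population h \<Longrightarrow> \<exists>a\<in>actions G (obj_type x). \<exists>r\<in>rules G (obj_type x) a.
       fmlookup m x = Some a \<and> fmlookup s x = Some (a, r)"
    using step_lookup[OF assms] by metis
  have "a \<in> actions G (obj_type x) \<and> r \<in> rules G (obj_type x) a" if "fmlookup s x = Some (a, r)" for x a r
    using m(2)[of x] that m(1) fmdom'I[OF that] by auto
  then show ?thesis
    unfolding extend_history_def using assms(4) m(1)
    by (cases h) (auto intro: histories.step)
qed

lemma expectation_step_ge:
  assumes "0 \<le> c" "\<And>s. 0 \<le> f s" "\<And>s. f s \<le> (1::real)"
    and "\<And>m. m \<in> legal_choices \<sigma> \<tau> h \<Longrightarrow> c \<le> measure_pmf.expectation (outcome_pmf G m) f"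
  shows "c \<le> measure_pmf.expectation (step_pmf G \<sigma> \<tau> h) f"
proof -
  have bd: "\<bar>f x\<bar> \<le> 1" for x
    using assms(2,3)[of x] by simp
  have le1: "measure_pmf.expectation p f \<le> 1" for p
    by (rule expectation_pmf_le_const) (auto simp: assms)
  have "c \<le> measure_pmf.expectation (outcome_pmf G (c' ++\<^sub>f d')) f"
    if "c' \<in> set_pmf (\<sigma> h)" "d' \<in> set_pmf (\<tau> h)" for c' d'
    using that by (intro assms(4)) (auto simp: legal_choices_def)
  then show ?thesis
    unfolding step_pmf_eq expectation_bind_pmf_bounded[OF bd]
    by (intro expectation_pmf_ge_const[where B = 1 and p = "\<sigma> h"]
        expectation_pmf_ge_const[where B = 1 and p = "\<tau> h"] expectation_pmf_le_const le1)
      (auto simp: assms)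
qed

lemma expectation_outcome_prod:
  fixes G :: "('t::finite, 'a) bssg"
  assumes "bssg G" "\<And>x a. fmlookup m x = Some a \<Longrightarrow> a \<in> actions G (obj_type x)"
    and "\<And>T. 0 \<le> v T"
  shows "measure_pmf.expectation (outcome_pmf G m) (\<lambda>s. \<Prod>y\<in>offspring s. v (obj_type y)) =
    (\<Prod>x\<in>fmdom' m. offspring_value G v (obj_type x) (the (fmlookup m x)))"
proof -
  have act: "the (fmlookup m x) \<in> actions G (obj_type x)" if "x \<in> fmdom' m" for x
    using that assms(2) by (auto simp: fmlookup_dom'_iff)
  have fin: "finite (set_pmf (rule_pmf G (obj_type x) (the (fmlookup m x))))" if "x \<in> fmdom' m" for x
    using assms(1) act[OF that] by (auto simp: set_rule_pmf bssg_def)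
  have dom: "fmdom' (fmmap_keys f m) = fmdom' m" for f :: "_ \<Rightarrow> 'a \<Rightarrow> 'a \<times> 't rule"
    by (auto simp: fmlookup_dom'_iff simp del: split_paired_Ex)
  have "measure_pmf.expectation (outcome_pmf G m) (\<lambda>s. \<Prod>y\<in>offspring s. v (obj_type y)) =
      measure_pmf.expectation
        (Pi_pmf (fmdom' m) undefined (\<lambda>x. rule_pmf G (obj_type x) (the (fmlookup m x))))
        (\<lambda>\<rho>. \<Prod>x\<in>fmdom' m. \<Prod>T\<in>UNIV. v T ^ snd (\<rho> x) T)"
    unfolding outcome_pmf_def integral_map_pmf prod_offspring dom
    by (intro Bochner_Integration.integral_cong refl prod.cong) (auto simp: fmlookup_dom'_iff)
  also have "\<dots> = (\<Prod>x\<in>fmdom' m. measure_pmf.expectation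
      (rule_pmf G (obj_type x) (the (fmlookup m x))) (\<lambda>r. \<Prod>T\<in>UNIV. v T ^ snd r T))"
    by (rule expectation_prod_Pi_pmf)
      (auto intro!: integrable_measure_pmf_finite fin prod_nonneg zero_le_power assms(3))
  also have "\<dots> = (\<Prod>x\<in>fmdom' m. offspring_value G v (obj_type x) (the (fmlookup m x)))"
    by (intro prod.cong refl expectation_rule_pmf assms(1) act)
  finally show ?thesis .
qed

lemma prob_outcome_lookup:
  assumes "bssg G" "fmlookup m x = Some a" "a \<in> actions G (obj_type x)" "r \<in> rules G (obj_type x) a"
  shows "measure_pmf.prob (outcome_pmf G m) {s. fmlookup s x = Some (a, r)} = real_of_rat (fst r)"
proof -
  let ?P = "Pi_pmf (fmdom' m) undefined (\<lambda>x. rule_pmf G (obj_type x) (the (fmlookup m x)))"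
  have x: "x \<in> fmdom' m"
    using assms(2) by (auto simp: fmlookup_dom'_iff)
  have "measure_pmf.prob (outcome_pmf G m) {s. fmlookup s x = Some (a, r)} =
      measure_pmf.prob ?P ((\<lambda>\<rho>. \<rho> x) -` {r})"
    unfolding outcome_pmf_def by (simp add: assms(2) vimage_def)
  also have "\<dots> = measure_pmf.prob (map_pmf (\<lambda>\<rho>. \<rho> x) ?P) {r}"
    by simp
  also have "\<dots> = pmf (rule_pmf G (obj_type x) a) r"
    using x assms(2) by (subst Pi_pmf_component) (auto simp: measure_pmf_single)
  finally show ?thesis
    using assms by (simp add: pmf_rule_pmf)
qed

lemma prob_step_ge:
  assumes "bssg G" "\<sigma> \<in> strategies G MaxPlayer" "\<tau> \<in> strategies G MinPlayer" "h \<in> histories G"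
    and p: "0 \<le> p" "\<And>T a r. a \<in> actions G T \<Longrightarrow> r \<in> rules G T a \<Longrightarrow> p \<le> real_of_rat (fst r)"
    and x: "x \<in> population h"
    and good: "\<And>m a. m \<in> legal_choices \<sigma> \<tau> h \<Longrightarrow> fmlookup m x = Some a \<Longrightarrow>
      \<exists>r\<in>rules G (obj_type x) a. good r"
  shows "p \<le> measure_pmf.prob (step_pmf G \<sigma> \<tau> h) {s. \<exists>a r. fmlookup s x = Some (a, r) \<and> good r}"
    (is "_ \<le> measure_pmf.prob _ ?E")
proof -
  have "p \<le> measure_pmf.expectation (step_pmf G \<sigma> \<tau> h) (indicator ?E)"
  proof (rule expectation_step_ge)
    fix m assume m: "m \<in> legal_choices \<sigma> \<tau> h"
    obtain a where a: "a \<in> actions G (obj_type x)" "fmlookup m x = Some a"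
      using legal_choices_lookup(2)[OF assms(2-4) m x] by auto
    obtain r where r: "r \<in> rules G (obj_type x) a" "good r"
      using good[OF m a(2)] by auto
    have "p \<le> real_of_rat (fst r)"
      using p(2) a r by auto
    also have "\<dots> = measure_pmf.prob (outcome_pmf G m) {s. fmlookup s x = Some (a, r)}"
      using prob_outcome_lookup[OF assms(1) a(2,1) r(1)] by simp
    also have "\<dots> \<le> measure_pmf.prob (outcome_pmf G m) ?E"
      using r(2) by (intro measure_pmf.finite_measure_mono) (auto simp del: split_paired_Ex)
    finally show "p \<le> measure_pmf.expectation (outcome_pmf G m) (indicator ?E)"
      by simp
  qed (use p in auto)
  then show ?thesis by simp
qed

lemma expectation_le_of_prob_ge:
  fixes f :: "'b \<Rightarrow> real"
  assumes "p \<le> measure_pmf.prob M E" "0 \<le> q" "q \<le> 1"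
    and "\<And>s. s \<in> set_pmf M \<Longrightarrow> 0 \<le> f s" "\<And>s. s \<in> set_pmf M \<Longrightarrow> f s \<le> 1"
    and "\<And>s. s \<in> set_pmf M \<Longrightarrow> s \<in> E \<Longrightarrow> f s \<le> 1 - q"
  shows "measure_pmf.expectation M f \<le> 1 - p * q"
proof -
  have "measure_pmf.expectation M f \<le> measure_pmf.expectation M (\<lambda>s. 1 - q * indicator E s)"
    using assms by (intro expectation_pmf_mono[where B = 1]) (auto simp: indicator_def)
  also have "\<dots> = 1 - q * measure_pmf.prob M E"
    by (subst Bochner_Integration.integral_diff)
      (auto intro!: integrable_measure_pmf_bounded[where B = 1])
  also have "\<dots> \<le> 1 - q * p"
    using assms(1,2) by (simp add: mult_left_mono)
  finally show ?thesis by (simp add: mult.commute)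
qed

definition choice_strategy :: "('t, 'a) bssg \<Rightarrow> player \<Rightarrow>
    (('t, 'a) history \<Rightarrow> 't obj \<Rightarrow> 'a) \<Rightarrow> ('t, 'a) strategy" where
  "choice_strategy G P act h = return_pmf (Abs_fmap
     (\<lambda>x. if x \<in> population h \<and> owner G (obj_type x) = P then Some (act h x) else None))"

lemma lookup_choice_strategy:
  fixes G :: "('t::finite, 'a) bssg"
  assumes "c \<in> set_pmf (choice_strategy G P act h)"
  shows "fmlookup c x = (if x \<in> population h \<and> owner G (obj_type x) = P then Some (act h x) else None)"
proof -
  have "finite (dom (\<lambda>x. if x \<in> population h \<and> owner G (obj_type x) = P then Some (act h x) else None))"
    by (rule finite_subset[OF _ finite_population[of h]]) (auto split: if_splits)
  then show ?thesis
    using assms by (simp add: choice_strategy_def Abs_fmap_inverse)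
qed

lemma choice_strategy_in_strategies:
  fixes G :: "('t::finite, 'a) bssg"
  assumes "\<And>h x. act h x \<in> actions G (obj_type x)"
  shows "choice_strategy G P act \<in> strategies G P"
  using assms unfolding strategies_def joint_actions_def
  by (auto simp: lookup_choice_strategy fmlookup_dom'_iff split: if_splits)

lemma deterministic_choice_strategy: "deterministic G (choice_strategy G P act)"
  by (auto simp: deterministic_def choice_strategy_def)

lemma legal_choices_Min:
  fixes G :: "('t::finite, 'a) bssg"
  assumes "m \<in> legal_choices \<sigma> (choice_strategy G MinPlayer act) h"
    and "x \<in> population h" "owner G (obj_type x) = MinPlayer"
  shows "fmlookup m x = Some (act h x)"
  using assms by (auto simp: legal_choices_def lookup_choice_strategy fmlookup_dom'_iff fmlookup_dom_iff)

lemma legal_choices_Max: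
  fixes G :: "('t::finite, 'a) bssg"
  assumes "m \<in> legal_choices (choice_strategy G MaxPlayer act) \<tau> h"
    and "\<tau> \<in> strategies G MinPlayer" "h \<in> histories G"
    and "x \<in> population h" "owner G (obj_type x) = MaxPlayer"
  shows "fmlookup m x = Some (act h x)"
proof -
  obtain c d where m: "m = c ++\<^sub>f d" "c \<in> set_pmf (choice_strategy G MaxPlayer act h)"
    "d \<in> joint_actions G MinPlayer h"
    using assms by (force simp: legal_choices_def strategies_def)
  then have "x \<notin> fmdom' d"
    using assms(5) by (auto simp: joint_actions_def)
  with m assms(4,5) show ?thesis
    by (auto simp: lookup_choice_strategy fmdom'_alt_def)
qed

subsection \<open>The greatest fixed point\<close>

lemma offspring_value_nonneg:
  assumes "bssg G" "a \<in> actions G T" "\<And>T. 0 \<le> v T"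
  shows "0 \<le> offspring_value G v T a"
  unfolding offspring_value_def using assms
  by (intro sum_nonneg mult_nonneg_nonneg prod_nonneg zero_le_power) (auto simp: bssg_def less_imp_le)

lemma offspring_value_mono:
  assumes "bssg G" "a \<in> actions G T" "\<And>T. 0 \<le> v T" "\<And>T. v T \<le> w T"
  shows "offspring_value G v T a \<le> offspring_value G w T a"
  unfolding offspring_value_def using assms
  by (intro sum_mono mult_left_mono prod_mono) (auto simp: bssg_def less_imp_le power_mono)

lemma offspring_value_const:
  assumes "bssg G" "a \<in> actions G T"
    and "\<And>r. r \<in> rules G T a \<Longrightarrow> (\<Prod>T'\<in>UNIV. v T' ^ snd r T') = c"
  shows "offspring_value G v T a = c"
proof -
  have "offspring_value G v T a = real_of_rat (\<Sum>r\<in>rules G T a. fst r) * c"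
    unfolding offspring_value_def by (simp add: assms(3) of_rat_sum sum_distrib_right)
  with assms(1,2) show ?thesis by (simp add: bssg_def)
qed

lemma offspring_value_eq_0:
  assumes "bssg G" "a \<in> actions G T" "\<And>T. 0 \<le> v T" "offspring_value G v T a = 0"
    and "r \<in> rules G T a"
  shows "\<exists>T'. v T' = 0 \<and> 0 < snd r T'"
proof -
  have "\<forall>r\<in>rules G T a. real_of_rat (fst r) * (\<Prod>T'\<in>UNIV. v T' ^ snd r T') = 0"
    using assms(1-4) unfolding offspring_value_def
    by (subst (asm) sum_nonneg_eq_0_iff)
      (auto simp: bssgD(3) intro!: mult_nonneg_nonneg prod_nonneg zero_le_power
        dest: bssgD(4)[OF assms(1,2)])
  moreover have "fst r \<noteq> 0"
    using bssgD(4)[OF assms(1,2,5)] by simp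
  ultimately have "(\<Prod>T'\<in>UNIV. v T' ^ snd r T') = 0"
    using assms(5) by auto
  then show ?thesis by auto
qed

text \<open>The post-fixed points of the min-max operator whose greatest fixed point is the value vector.\<close>
definition subinvariant :: "('t::finite, 'a) bssg \<Rightarrow> 't \<Rightarrow> ('t \<Rightarrow> real) \<Rightarrow> bool" where
  "subinvariant G target v \<longleftrightarrow> (\<forall>T. 0 \<le> v T \<and> v T \<le> 1) \<and> v target = 0 \<and>
     (\<forall>T. T \<noteq> target \<longrightarrow>
       (if owner G T = MaxPlayer then \<exists>a\<in>actions G T. v T \<le> offspring_value G v T a
        else \<forall>a\<in>actions G T. v T \<le> offspring_value G v T a))"

lemma subinvariantD:
  assumes "subinvariant G target v"
  shows "0 \<le> v T" "v T \<le> 1" "v target = 0"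
    and "T \<noteq> target \<Longrightarrow> owner G T = MaxPlayer \<Longrightarrow> \<exists>a\<in>actions G T. v T \<le> offspring_value G v T a"
    and "T \<noteq> target \<Longrightarrow> owner G T \<noteq> MaxPlayer \<Longrightarrow> a \<in> actions G T \<Longrightarrow>
      v T \<le> offspring_value G v T a"
  using assms by (simp_all add: subinvariant_def)

lemma subinvariant_zero: "bssg G \<Longrightarrow> subinvariant G target (\<lambda>_. 0)"
  using bssgD(2)[of G] offspring_value_nonneg[of G _ _ "\<lambda>_. 0"]
  by (auto simp: subinvariant_def)

lemma subinvariant_le_avoid_prob:
  fixes G :: "('t::finite, 'a) bssg"
  assumes "bssg G" "\<tau> \<in> strategies G MinPlayer" "h \<in> histories G"
    and v: "subinvariant G target v"
    and act: "\<And>T. act T \<in> actions G T"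
    and opt: "\<And>T. T \<noteq> target \<Longrightarrow> owner G T = MaxPlayer \<Longrightarrow> v T \<le> offspring_value G v T (act T)"
  defines "\<sigma> \<equiv> choice_strategy G MaxPlayer (\<lambda>h x. act (obj_type x))"
  shows "(\<Prod>x\<in>population h. v (obj_type x)) \<le> avoid_prob G target \<sigma> \<tau> k h"
  using assms(3)
proof (induction k arbitrary: h)
  case (0 h)
  have "(\<Prod>x\<in>population h. v (obj_type x)) \<le> 1"
    using v by (intro prod_le_1) (auto simp: subinvariant_def)
  moreover have "(\<Prod>x\<in>population h. v (obj_type x)) = 0" if "\<not> safe target h"
    using that v finite_population[of h] by (auto simp: safe_def subinvariant_def)
  ultimately show ?case by auto
next
  case (Suc k h)
  have v01: "0 \<le> v T" "v T \<le> 1" for T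
    using v by (auto simp: subinvariant_def)
  have \<sigma>: "\<sigma> \<in> strategies G MaxPlayer"
    unfolding \<sigma>_def by (rule choice_strategy_in_strategies) (rule act)
  show ?case
  proof (cases "safe target h")
    case False
    then have "(\<Prod>x\<in>population h. v (obj_type x)) = 0"
      using v finite_population[of h] by (auto simp: safe_def subinvariant_def)
    then show ?thesis
      by (simp add: avoid_prob_bounds del: avoid_prob.simps)
  next
    case True
    have "(\<Prod>x\<in>population h. v (obj_type x)) \<le> measure_pmf.expectation (step_pmf G \<sigma> \<tau> h)
        (\<lambda>s. \<Prod>y\<in>offspring s. v (obj_type y))"
    proof (rule expectation_step_ge)
      fix m assume m: "m \<in> legal_choices \<sigma> \<tau> h"
      note lk = legal_choices_lookup[OF \<sigma> assms(2) Suc.prems m]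
      have lk': "a \<in> actions G (obj_type x)" if "fmlookup m x = Some a" for x a
        using lk(2)[of x] that lk(1) fmdom'I[OF that] by auto
      have "v (obj_type x) \<le> offspring_value G v (obj_type x) (the (fmlookup m x))"
        if x: "x \<in> population h" for x
      proof (cases "owner G (obj_type x)")
        case MaxPlayer
        then show ?thesis
          using opt True x legal_choices_Max[OF m[unfolded \<sigma>_def] assms(2) Suc.prems x]
          by (auto simp: safe_def)
      next
        case MinPlayer
        then show ?thesis
          using v True x lk(2)[OF x] by (auto simp: safe_def subinvariant_def)
      qed
      then show "(\<Prod>x\<in>population h. v (obj_type x)) \<le> measure_pmf.expectation (outcome_pmf G m)
          (\<lambda>s. \<Prod>y\<in>offspring s. v (obj_type y))"
        by (subst expectation_outcome_prod[OF assms(1) lk' v01(1)])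
          (auto simp: lk(1) v01 intro!: prod_mono)
    qed (auto simp: v01 intro!: prod_nonneg prod_le_1)
    also have "\<dots> \<le> measure_pmf.expectation (step_pmf G \<sigma> \<tau> h)
        (\<lambda>s. avoid_prob G target \<sigma> \<tau> k (extend_history h s))"
      using Suc.IH[OF extend_histories[OF assms(1) \<sigma> assms(2) Suc.prems]]
      by (intro expectation_pmf_mono[where B = 1] avoid_prob_bounds) (auto simp: v01 intro!: prod_nonneg)
    finally show ?thesis
      using True by simp
  qed
qed

definition game_value :: "('t::finite, 'a) bssg \<Rightarrow> 't \<Rightarrow> 't \<Rightarrow> real" where
  "game_value G target T = (SUP v\<in>{v. subinvariant G target v}. v T)"

lemma subinvariant_le_game_value:
  assumes "subinvariant G target v"
  shows "v T \<le> game_value G target T"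
  unfolding game_value_def
  by (rule cSUP_upper) (use assms in \<open>auto simp: subinvariant_def intro!: bdd_aboveI2[where M = 1]\<close>)

lemma game_value_le:
  assumes "bssg G" "\<And>v. subinvariant G target v \<Longrightarrow> v T \<le> c"
  shows "game_value G target T \<le> c"
  unfolding game_value_def
  by (rule cSUP_least) (use assms subinvariant_zero in auto)

lemma subinvariant_game_value:
  fixes G :: "('t::finite, 'a) bssg"
  assumes "bssg G"
  shows "subinvariant G target (game_value G target)"
proof -
  let ?g = "game_value G target"
  have nonneg: "0 \<le> ?g T" for T
    using subinvariant_le_game_value[OF subinvariant_zero[OF assms]] .
  have le: "offspring_value G v T a \<le> offspring_value G ?g T a"
    if "subinvariant G target v" "a \<in> actions G T" for v T a
    using that subinvariant_le_game_value[OF that(1)]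
    by (intro offspring_value_mono assms) (auto simp: subinvariant_def)
  have "?g T \<le> 1" for T
    by (rule game_value_le[OF assms]) (auto simp: subinvariant_def)
  moreover have "?g target = 0"
    using nonneg[of target] game_value_le[OF assms, of target target 0]
    by (force simp: subinvariant_def)
  moreover have "\<exists>a\<in>actions G T. ?g T \<le> offspring_value G ?g T a"
    if T: "T \<noteq> target" "owner G T = MaxPlayer" for T
  proof -
    let ?O = "offspring_value G ?g T ` actions G T"
    have fin: "finite ?O" "?O \<noteq> {}"
      using assms by (auto simp: bssg_def)
    have "?g T \<le> Max ?O"
    proof (rule game_value_le[OF assms])
      fix v assume v: "subinvariant G target v"
      with T obtain a where "a \<in> actions G T" "v T \<le> offspring_value G v T a"
        using subinvariantD(4)[OF v] by blast
      with le[OF v] fin show "v T \<le> Max ?O"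
        by (meson Max_ge imageI order_trans)
    qed
    moreover have "Max ?O \<in> ?O"
      using fin by (rule Max_in)
    ultimately show ?thesis by auto
  qed
  moreover have "?g T \<le> offspring_value G ?g T a"
    if T: "T \<noteq> target" "owner G T \<noteq> MaxPlayer" "a \<in> actions G T" for T a
  proof (rule game_value_le[OF assms])
    fix v assume v: "subinvariant G target v"
    with T have "v T \<le> offspring_value G v T a"
      by (auto simp: subinvariant_def)
    with le[OF v T(3)] show "v T \<le> offspring_value G ?g T a" by simp
  qed
  ultimately show ?thesis
    using nonneg by (auto simp: subinvariant_def)
qed

lemma nonreach_prob_bounds: "0 \<le> nonreach_prob G target \<mu> \<sigma> \<tau>" "nonreach_prob G target \<mu> \<sigma> \<tau> \<le> 1"
  using prob_space.prob_le_1[OF prob_space_play_measure] by (auto simp: nonreach_prob_def)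

lemma roots_singleton_pop: "roots (singleton_pop T) = {[(T, 0)]}"
  by (auto simp: roots_def singleton_pop_def)

lemma game_value_le_nonreach_value:
  fixes G :: "('t::finite, 'a::countable) bssg"
  assumes "bssg G"
  shows "game_value G target T \<le> nonreach_value G target T"
proof -
  let ?g = "game_value G target" and ?\<mu> = "singleton_pop T"
  note sub = subinvariant_game_value[OF assms, of target]
  have "\<exists>a\<in>actions G T. T \<noteq> target \<longrightarrow> owner G T = MaxPlayer \<longrightarrow> ?g T \<le> offspring_value G ?g T a" for T
    using subinvariantD(4)[OF sub] bssgD(2)[OF assms] by blast
  then obtain act where act: "\<And>T. act T \<in> actions G T"
    "\<And>T. T \<noteq> target \<Longrightarrow> owner G T = MaxPlayer \<Longrightarrow> ?g T \<le> offspring_value G ?g T (act T)"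
    by metis
  define \<sigma> where "\<sigma> = choice_strategy G MaxPlayer (\<lambda>h x. act (obj_type x))"
  have \<sigma>: "\<sigma> \<in> strategies G MaxPlayer"
    unfolding \<sigma>_def by (rule choice_strategy_in_strategies) (rule act)
  have ne: "strategies G MinPlayer \<noteq> {}"
    using choice_strategy_in_strategies[of "\<lambda>h x. act (obj_type x)" G MinPlayer] act by auto
  have bdd: "bdd_below ((\<lambda>\<tau>. nonreach_prob G target ?\<mu> \<sigma>' \<tau>) ` strategies G MinPlayer)" for \<sigma>'
    by (auto intro!: bdd_belowI2[where m = 0] nonreach_prob_bounds)
  have "?g T \<le> nonreach_prob G target ?\<mu> \<sigma> \<tau>" if \<tau>: "\<tau> \<in> strategies G MinPlayer" for \<tau>
  proof (rule LIMSEQ_le_const[OF nonreach_prob_limit], intro exI allI impI)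
    fix k
    have "(\<Prod>x\<in>population (?\<mu>, [] :: ('t, 'a) step list). ?g (obj_type x)) \<le> avoid_prob G target \<sigma> \<tau> k (?\<mu>, [])"
      unfolding \<sigma>_def
      by (rule subinvariant_le_avoid_prob[OF assms \<tau> histories.init sub, where act = act]) (auto simp: act)
    then show "?g T \<le> avoid_prob G target \<sigma> \<tau> k (?\<mu>, [])"
      by (simp add: population_def roots_singleton_pop obj_type_def)
  qed
  then have "?g T \<le> (INF \<tau>\<in>strategies G MinPlayer. nonreach_prob G target ?\<mu> \<sigma> \<tau>)"
    by (intro cINF_greatest ne)
  also have "\<dots> \<le> nonreach_value G target T"
    unfolding nonreach_value_def
  proof (rule cSUP_upper[OF \<sigma>], rule bdd_aboveI2[where M = 1])
    fix \<sigma>'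
    obtain \<tau> where "\<tau> \<in> strategies G MinPlayer"
      using ne by auto
    then show "(INF \<tau>\<in>strategies G MinPlayer. nonreach_prob G target ?\<mu> \<sigma>' \<tau>) \<le> 1"
      by (rule cINF_lower2[OF bdd]) (rule nonreach_prob_bounds)
  qed
  finally show ?thesis .
qed

subsection \<open>Attractors\<close>

primrec attractor :: "('t, 'a) bssg \<Rightarrow> 't \<Rightarrow> ('t \<Rightarrow> 'a \<Rightarrow> 't set \<Rightarrow> bool) \<Rightarrow> nat \<Rightarrow> 't set" where
  "attractor G target C 0 = {target}"
| "attractor G target C (Suc n) = attractor G target C n \<union>
     {T. if owner G T = MaxPlayer then \<forall>a\<in>actions G T. C T a (attractor G target C n)
         else \<exists>a\<in>actions G T. C T a (attractor G target C n)}"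

lemma attractor_mono: "m \<le> n \<Longrightarrow> attractor G target C m \<subseteq> attractor G target C n"
  by (rule lift_Suc_mono_le[of "attractor G target C"]) auto

lemma target_in_attractor: "target \<in> attractor G target C n"
  using attractor_mono[of 0 n] by auto

lemma attractor_stable:
  fixes G :: "('t::finite, 'a) bssg"
  obtains N where "\<And>n. attractor G target C n \<subseteq> attractor G target C N"
proof -
  have "\<exists>i. \<forall>n. T \<in> attractor G target C n \<longrightarrow> T \<in> attractor G target C i" for T
    by blast
  then have "\<exists>f. \<forall>T n. T \<in> attractor G target C n \<longrightarrow> T \<in> attractor G target C (f T)"
    by (rule choice[OF allI])
  then obtain f where f: "\<And>T n. T \<in> attractor G target C n \<Longrightarrow> T \<in> attractor G target C (f T)"
    by blast
  have "f T \<le> Max (range f)" for T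
    by (rule Max_ge) auto
  then have "attractor G target C n \<subseteq> attractor G target C (Max (range f))" for n
    using f[of _ n] attractor_mono[of "f _" "Max (range f)" G target C] by fast
  then show ?thesis by (rule that)
qed

lemma not_in_stable_attractor:
  assumes "attractor G target C (Suc N) \<subseteq> attractor G target C N" "T \<notin> attractor G target C N"
  shows "if owner G T = MaxPlayer then \<exists>a\<in>actions G T. \<not> C T a (attractor G target C N)
    else \<forall>a\<in>actions G T. \<not> C T a (attractor G target C N)"
  using assms by (auto split: if_splits)

lemma attractor_choice:
  fixes G :: "('t::finite, 'a) bssg"
  assumes "bssg G" and mono: "\<And>T a X Y. X \<subseteq> Y \<Longrightarrow> C T a X \<Longrightarrow> C T a Y"
  obtains d where "\<And>T. d T \<in> actions G T"
    "\<And>n T a. T \<in> attractor G target C (Suc n) \<Longrightarrow> T \<noteq> target \<Longrightarrow> a \<in> actions G T \<Longrightarrow>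
      owner G T = MaxPlayer \<or> a = d T \<Longrightarrow> C T a (attractor G target C n)"
proof -
  define ok where "ok T b \<longleftrightarrow> b \<in> actions G T \<and>
    (\<forall>n a. T \<in> attractor G target C (Suc n) \<longrightarrow> T \<noteq> target \<longrightarrow> a \<in> actions G T \<longrightarrow>
      owner G T = MaxPlayer \<or> a = b \<longrightarrow> C T a (attractor G target C n))" for T b
  have "\<exists>b. ok T b" for T
  proof (cases "T \<noteq> target \<and> (\<exists>n. T \<in> attractor G target C n)")
    case True
    define i where "i = (LEAST n. T \<in> attractor G target C n)"
    have i: "T \<in> attractor G target C i" "\<And>n. T \<in> attractor G target C n \<Longrightarrow> i \<le> n"
      using True by (auto simp: i_def intro: LeastI Least_le)
    with True obtain j where j: "i = Suc j"
      by (cases i) auto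
    with i have "T \<notin> attractor G target C j"
      by fastforce
    with i(1) have C: "if owner G T = MaxPlayer then \<forall>a\<in>actions G T. C T a (attractor G target C j)
         else \<exists>a\<in>actions G T. C T a (attractor G target C j)"
      by (simp add: j)
    moreover obtain a0 where "a0 \<in> actions G T"
      using bssgD(2)[OF assms(1)] by auto
    ultimately obtain b where b: "b \<in> actions G T"
      "\<And>a. a \<in> actions G T \<Longrightarrow> owner G T = MaxPlayer \<or> a = b \<Longrightarrow> C T a (attractor G target C j)"
      by (auto split: if_splits)
    have "attractor G target C j \<subseteq> attractor G target C n" if "T \<in> attractor G target C (Suc n)" for n
      using i(2)[OF that] j by (intro attractor_mono) simp
    then have "ok T b"
      unfolding ok_def using b mono by blast
    then show ?thesis ..
  next
    case False
    moreover obtain b where "b \<in> actions G T"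
      using bssgD(2)[OF assms(1)] by auto
    ultimately have "ok T b"
      unfolding ok_def by blast
    then show ?thesis ..
  qed
  then obtain d where "\<And>T. ok T (d T)"
    by metis
  then show ?thesis
    using that[of d] unfolding ok_def by blast
qed

definition can_reach :: "('t, 'a) bssg \<Rightarrow> 't \<Rightarrow> 'a \<Rightarrow> 't set \<Rightarrow> bool" where
  "can_reach G T a X \<longleftrightarrow> (\<exists>r\<in>rules G T a. \<exists>T'\<in>X. 0 < snd r T')"

text \<open>\<open>offspring_value = 0\<close> says that every rule has a child of value \<open>0\<close>.  With two children in \<open>D\<close>,
  one of them is free to head for the target while the other continues the main line.\<close>
definition can_branch :: "('t::finite, 'a) bssg \<Rightarrow> 't \<Rightarrow> 't set \<Rightarrow> 't \<Rightarrow> 'a \<Rightarrow> 't set \<Rightarrow> bool" where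
  "can_branch G target D T a X \<longleftrightarrow> game_value G target T = 0 \<and>
     offspring_value G (game_value G target) T a = 0 \<and>
     (\<exists>r\<in>rules G T a. 2 \<le> (\<Sum>T'\<in>D. snd r T') \<or> (\<exists>T'\<in>X. 0 < snd r T'))"

lemma can_reach_mono: "X \<subseteq> Y \<Longrightarrow> can_reach G T a X \<Longrightarrow> can_reach G T a Y"
  unfolding can_reach_def by blast

lemma can_branch_mono: "X \<subseteq> Y \<Longrightarrow> can_branch G target D T a X \<Longrightarrow> can_branch G target D T a Y"
  unfolding can_branch_def by blast

lemma game_value_outside_attractor:
  fixes G :: "('t::finite, 'a) bssg"
  assumes "bssg G"
    and N: "attractor G target (can_reach G) (Suc N) \<subseteq> attractor G target (can_reach G) N"
    and "T \<notin> attractor G target (can_reach G) N"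
  shows "game_value G target T = 1"
proof -
  let ?D = "attractor G target (can_reach G) N"
  let ?v = "\<lambda>T. of_bool (T \<notin> ?D) :: real"
  have one: "offspring_value G ?v T a = 1" if "a \<in> actions G T" "\<not> can_reach G T a ?D" for T a
    using that(2) by (intro offspring_value_const assms that prod.neutral) (auto simp: can_reach_def)
  have "if owner G T = MaxPlayer then \<exists>a\<in>actions G T. ?v T \<le> offspring_value G ?v T a
        else \<forall>a\<in>actions G T. ?v T \<le> offspring_value G ?v T a" for T
  proof (cases "T \<in> ?D")
    case True
    then show ?thesis
      using bssgD(2)[OF assms(1)] offspring_value_nonneg[OF assms(1), where v = ?v] by auto
  next
    case False
    show ?thesis
    proof (cases "owner G T = MaxPlayer")
      case True
      then obtain a where "a \<in> actions G T" "\<not> can_reach G T a ?D"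
        using not_in_stable_attractor[OF N False] by auto
      with one[of a T] True show ?thesis by (auto intro!: bexI[of _ a])
    next
      case False
      with not_in_stable_attractor[OF N \<open>T \<notin> ?D\<close>] one show ?thesis by auto
    qed
  qed
  then have "subinvariant G target ?v"
    by (simp add: subinvariant_def target_in_attractor)
  from subinvariant_le_game_value[OF this, of T]
    subinvariantD(2)[OF subinvariant_game_value[OF assms(1)], of target T]
  show ?thesis
    using assms(3) by simp
qed

lemma prod_power_single_nontrivial:
  fixes v :: "'t::finite \<Rightarrow> real"
  assumes "T \<in> D" "0 < \<alpha> T" "(\<Sum>T\<in>D. \<alpha> T) < (2::nat)" "\<And>T. T \<notin> D \<Longrightarrow> v T = 1"
  shows "(\<Prod>T\<in>UNIV. v T ^ \<alpha> T) = v T"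
proof -
  have sum: "(\<Sum>T\<in>D. \<alpha> T) = \<alpha> T + (\<Sum>T\<in>D - {T}. \<alpha> T)"
    using assms(1) by (simp add: sum.remove)
  then have \<alpha>: "\<alpha> T = 1" "(\<Sum>T\<in>D - {T}. \<alpha> T) = 0"
    using assms(2,3) by linarith+
  then have "v T' ^ \<alpha> T' = 1" if "T' \<noteq> T" for T'
    using that assms(4)[of T'] by (cases "T' \<in> D") auto
  then have "(\<Prod>T\<in>UNIV - {T}. v T ^ \<alpha> T) = 1"
    by (intro prod.neutral) auto
  then show ?thesis
    using \<alpha>(1) by (subst prod.remove[of _ T]) auto
qed

lemma positive_offspring_value_bound:
  fixes G :: "('t::finite, 'a) bssg"
  assumes "bssg G"
  obtains \<epsilon> where "0 < \<epsilon>" "\<epsilon> \<le> 1"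
    "\<And>T a. a \<in> actions G T \<Longrightarrow> 0 < offspring_value G v T a \<Longrightarrow> \<epsilon> \<le> offspring_value G v T a"
proof -
  define V where "V = insert 1 {c \<in> (\<lambda>(T, a). offspring_value G v T a) ` (SIGMA T:UNIV. actions G T). 0 < c}"
  have V: "finite V" "V \<noteq> {}"
    using bssgD(1)[OF assms] by (auto simp: V_def)
  then have "Min V \<in> V" by simp
  then have "0 < Min V" by (auto simp: V_def)
  moreover have "Min V \<le> 1"
    using V by (simp add: V_def)
  moreover have "Min V \<le> offspring_value G v T a"
    if "a \<in> actions G T" "0 < offspring_value G v T a" for T a
    using V(1) by (rule Min_le) (use that in \<open>force simp: V_def\<close>)
  ultimately show ?thesis by (rule that)
qed

lemma min_rule_prob:
  fixes G :: "('t::finite, 'a) bssg"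
  assumes "bssg G"
  obtains p where "0 < p" "p \<le> 1"
    "\<And>T a r. a \<in> actions G T \<Longrightarrow> r \<in> rules G T a \<Longrightarrow> p \<le> real_of_rat (fst r)"
proof -
  define V where "V = insert 1 ((\<lambda>(T, a, r). real_of_rat (fst r)) `
    (SIGMA T:UNIV. SIGMA a:actions G T. rules G T a))"
  have V: "finite V" "V \<noteq> {}"
    using bssgD(1,3)[OF assms] by (auto simp: V_def)
  then have "Min V \<in> V" by simp
  then have "0 < Min V"
    using bssgD(4)[OF assms] by (force simp: V_def)
  moreover have "Min V \<le> 1"
    using V by (simp add: V_def)
  moreover have "Min V \<le> real_of_rat (fst r)"
    if "a \<in> actions G T" "r \<in> rules G T a" for T a r
    using V(1) by (rule Min_le) (use that in \<open>force simp: V_def\<close>)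
  ultimately show ?thesis by (rule that)
qed

text \<open>Otherwise \<open>g\<close> could be raised to \<open>\<epsilon>\<close> on the remaining types: an action without a good rule
  leads from such a type to exactly one such child, all other children having value \<open>1\<close>.\<close>
lemma value_zero_subset_branch_attractor:
  fixes G :: "('t::finite, 'a) bssg"
  assumes "bssg G"
    and D: "\<And>T. T \<notin> D \<Longrightarrow> game_value G target T = 1"
  defines "R \<equiv> attractor G target (can_branch G target D)"
  assumes M: "R (Suc M) \<subseteq> R M" and T: "game_value G target T = 0"
  shows "T \<in> R M"
proof (rule ccontr)
  assume "T \<notin> R M"
  let ?g = "game_value G target"
  note sub = subinvariant_game_value[OF assms(1), of target]
  obtain \<epsilon> where \<epsilon>: "0 < \<epsilon>" "\<epsilon> \<le> 1"
    "\<And>T a. a \<in> actions G T \<Longrightarrow> 0 < offspring_value G ?g T a \<Longrightarrow> \<epsilon> \<le> offspring_value G ?g T a"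
    using positive_offspring_value_bound[OF assms(1)] by metis
  define B where "B = {T. ?g T = 0} - R M"
  define v where "v T = (if T \<in> B then \<epsilon> else ?g T)" for T
  have g_le_v: "?g T \<le> v T" for T
    using \<epsilon>(1) by (auto simp: v_def B_def)
  have mono: "offspring_value G ?g T a \<le> offspring_value G v T a" if "a \<in> actions G T" for T a
    using that by (intro offspring_value_mono assms(1) subinvariantD(1)[OF sub] g_le_v)
  have target: "target \<notin> B"
    by (simp add: B_def R_def target_in_attractor)
  have stuck: "\<epsilon> \<le> offspring_value G v T a"
    if "T \<in> B" and a: "a \<in> actions G T" and no: "\<not> can_branch G target D T a (R M)" for T a
  proof (cases "offspring_value G ?g T a = 0")
    case False
    then have "0 < offspring_value G ?g T a"
      using offspring_value_nonneg[OF assms(1) a, of ?g] subinvariantD(1)[OF sub] by fastforce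
    with \<epsilon>(3)[OF a] mono[OF a] show ?thesis by fastforce
  next
    case True
    have "offspring_value G v T a = \<epsilon>"
    proof (rule offspring_value_const[OF assms(1) a])
      fix r assume r: "r \<in> rules G T a"
      obtain T' where T': "?g T' = 0" "0 < snd r T'"
        using offspring_value_eq_0[OF assms(1) a subinvariantD(1)[OF sub] True r] by auto
      have "\<not> (2 \<le> (\<Sum>T'\<in>D. snd r T') \<or> (\<exists>T'\<in>R M. 0 < snd r T'))"
        using no True r \<open>T \<in> B\<close> by (simp add: can_branch_def B_def)
      then have "(\<Sum>T'\<in>D. snd r T') < 2" "T' \<notin> R M"
        using T' by auto
      moreover have "T' \<in> D"
        using D T' by force
      moreover have "v T'' = 1" if "T'' \<notin> D" for T''
        using D[OF that] by (simp add: v_def B_def)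
      ultimately have "(\<Prod>T'\<in>UNIV. v T' ^ snd r T') = v T'"
        using T' by (intro prod_power_single_nontrivial[of _ D])
      also have "v T' = \<epsilon>"
        using T' \<open>T' \<notin> R M\<close> by (simp add: v_def B_def)
      finally show "(\<Prod>T'\<in>UNIV. v T' ^ snd r T') = \<epsilon>" .
    qed
    then show ?thesis by simp
  qed
  have "if owner G T = MaxPlayer then \<exists>a\<in>actions G T. v T \<le> offspring_value G v T a
      else \<forall>a\<in>actions G T. v T \<le> offspring_value G v T a" if "T \<noteq> target" for T
  proof (cases "T \<in> B")
    case True
    then have v: "v T = \<epsilon>" and "T \<notin> R M"
      by (simp_all add: v_def B_def)
    then show ?thesis
      using not_in_stable_attractor[OF M[unfolded R_def], of T] stuck[OF True]
      unfolding R_def v by (auto split: if_splits)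
  next
    case False
    then have v: "v T = ?g T" by (simp add: v_def)
    show ?thesis
    proof (cases "owner G T = MaxPlayer")
      case True
      with subinvariantD(4)[OF sub that] obtain a where
        "a \<in> actions G T" "?g T \<le> offspring_value G ?g T a" by auto
      with True v order_trans[OF _ mono] show ?thesis by auto
    next
      case False
      with subinvariantD(5)[OF sub that] v order_trans[OF _ mono] show ?thesis by auto
    qed
  qed
  moreover have "0 \<le> v T" "v T \<le> 1" for T
    using \<epsilon>(1,2) subinvariantD(1,2)[OF sub] by (simp_all add: v_def)
  moreover have "v target = 0"
    using subinvariantD(3)[OF sub] target by (simp add: v_def)
  ultimately have "subinvariant G target v"
    by (simp add: subinvariant_def)
  from subinvariant_le_game_value[OF this, of T] show False
    using T \<open>T \<notin> R M\<close> \<epsilon>(1) by (simp add: v_def B_def)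
qed

subsection \<open>The strategy of the minimizer\<close>

text \<open>The choice is meaningful as long as the main object has a child with type in \<open>F\<close>, which can fail
  only once the target has been reached.\<close>
definition main_obj :: "'t set \<Rightarrow> ('t, 'a) history \<Rightarrow> 't obj" where
  "main_obj F h = foldl (\<lambda>x s. SOME y. y \<in> offspring s \<and> tl y = x \<and> obj_type y \<in> F)
     (SOME x. x \<in> roots (fst h) \<and> obj_type x \<in> F) (snd h)"

lemma main_obj_extend:
  "main_obj F (extend_history h s) = (SOME y. y \<in> offspring s \<and> tl y = main_obj F h \<and> obj_type y \<in> F)"
  by (simp add: main_obj_def extend_history_def)

lemma child_in_offspring:
  "fmlookup s x = Some (a, r) \<Longrightarrow> j < snd r T \<Longrightarrow> (T, j) # x \<in> offspring s"
  by (cases r) (auto simp: offspring_def)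

locale main_play =
  fixes G :: "('t::finite, 'a) bssg" and target :: 't and F :: "'t set"
    and f d :: "'t \<Rightarrow> 'a" and D R :: "nat \<Rightarrow> 't set" and N M :: nat and p :: real
    and \<sigma> :: "('t, 'a) strategy"
  assumes G: "bssg G" and \<sigma>: "\<sigma> \<in> strategies G MaxPlayer"
    and f: "\<And>T. f T \<in> actions G T" and d: "\<And>T. d T \<in> actions G T"
    and main_child: "\<And>T a r. T \<in> F \<Longrightarrow> T \<noteq> target \<Longrightarrow> a \<in> actions G T \<Longrightarrow>
      owner G T = MaxPlayer \<or> a = f T \<Longrightarrow> r \<in> rules G T a \<Longrightarrow> \<exists>T'\<in>F. 0 < snd r T'"
    and D_0: "D 0 = {target}" and R_0: "R 0 = {target}"
    and D_Suc: "\<And>n T a. T \<in> D (Suc n) \<Longrightarrow> T \<noteq> target \<Longrightarrow> a \<in> actions G T \<Longrightarrow>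
      owner G T = MaxPlayer \<or> a = d T \<Longrightarrow> \<exists>r\<in>rules G T a. \<exists>T'\<in>D n. 0 < snd r T'"
    and R_Suc: "\<And>n T a. T \<in> R (Suc n) \<Longrightarrow> T \<noteq> target \<Longrightarrow> a \<in> actions G T \<Longrightarrow>
      owner G T = MaxPlayer \<or> a = f T \<Longrightarrow>
      \<exists>r\<in>rules G T a. 2 \<le> (\<Sum>T'\<in>D N. snd r T') \<or> (\<exists>T'\<in>R n. 0 < snd r T')"
    and R_le_D: "\<And>n. R n \<subseteq> D N" and F_le_R: "F \<subseteq> R M"
    and p: "0 < p" "p \<le> 1"
      "\<And>T a r. a \<in> actions G T \<Longrightarrow> r \<in> rules G T a \<Longrightarrow> p \<le> real_of_rat (fst r)"
begin

definition \<tau> :: "('t, 'a) strategy" where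
  "\<tau> = choice_strategy G MinPlayer
     (\<lambda>h x. if x = main_obj F h then f (obj_type x) else d (obj_type x))"

lemma \<tau>: "\<tau> \<in> strategies G MinPlayer"
  unfolding \<tau>_def by (rule choice_strategy_in_strategies) (auto simp: f d)

definition tracked :: "('t, 'a) history \<Rightarrow> bool" where
  "tracked h \<longleftrightarrow> h \<in> histories G \<and> main_obj F h \<in> population h \<and> obj_type (main_obj F h) \<in> F"

lemma legal_\<tau>:
  assumes "h \<in> histories G" "x \<in> population h" "m \<in> legal_choices \<sigma> \<tau> h" "fmlookup m x = Some a"
  shows "a \<in> actions G (obj_type x)"
    and "owner G (obj_type x) = MaxPlayer \<or>
      a = (if x = main_obj F h then f (obj_type x) else d (obj_type x))"
proof -
  show "a \<in> actions G (obj_type x)"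
    using legal_choices_lookup(2)[OF \<sigma> \<tau> assms(1,3,2)] assms(4) by auto
  show "owner G (obj_type x) = MaxPlayer \<or>
      a = (if x = main_obj F h then f (obj_type x) else d (obj_type x))"
    using legal_choices_Min[OF assms(3)[unfolded \<tau>_def] assms(2)] assms(4)
    by (cases "owner G (obj_type x)") auto
qed

lemma tracked_extend:
  assumes "tracked h" "safe target h" "s \<in> set_pmf (step_pmf G \<sigma> \<tau> h)"
  shows "tracked (extend_history h s)" "tl (main_obj F (extend_history h s)) = main_obj F h"
proof -
  let ?x = "main_obj F h"
  have h: "h \<in> histories G" and x: "?x \<in> population h" "obj_type ?x \<in> F" "obj_type ?x \<noteq> target"
    using assms(1,2) by (auto simp: tracked_def safe_def)
  obtain m where m: "m \<in> legal_choices \<sigma> \<tau> h"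
    "\<And>x. x \<in> population h \<Longrightarrow> \<exists>a\<in>actions G (obj_type x). \<exists>r\<in>rules G (obj_type x) a.
       fmlookup m x = Some a \<and> fmlookup s x = Some (a, r)"
    using step_lookup[OF G \<sigma> \<tau> h assms(3)] by metis
  then obtain a r where ar: "a \<in> actions G (obj_type ?x)" "r \<in> rules G (obj_type ?x) a"
    "fmlookup m ?x = Some a" "fmlookup s ?x = Some (a, r)"
    using x(1) by blast
  have "owner G (obj_type ?x) = MaxPlayer \<or> a = f (obj_type ?x)"
    using legal_\<tau>(2)[OF h x(1) m(1) ar(3)] by simp
  then obtain T' where "T' \<in> F" "0 < snd r T'"
    using main_child[OF x(2,3) ar(1)] ar(2) by blast
  then have "\<exists>y. y \<in> offspring s \<and> tl y = ?x \<and> obj_type y \<in> F"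
    using child_in_offspring[OF ar(4), of 0 T'] by (auto simp: obj_type_def intro!: exI[of _ "(T', 0) # ?x"])
  then have "main_obj F (extend_history h s) \<in> offspring s \<and> tl (main_obj F (extend_history h s)) = ?x \<and>
      obj_type (main_obj F (extend_history h s)) \<in> F"
    unfolding main_obj_extend by (rule someI_ex)
  then show "tracked (extend_history h s)" "tl (main_obj F (extend_history h s)) = main_obj F h"
    using extend_histories[OF G \<sigma> \<tau> h assms(3)] by (auto simp: tracked_def)
qed

lemma avoid_prob_Suc_le:
  assumes "tracked h" "safe target h" "0 \<le> q" "q \<le> 1" "x \<in> population h"
    and "\<And>m a. m \<in> legal_choices \<sigma> \<tau> h \<Longrightarrow> fmlookup m x = Some a \<Longrightarrow>
      \<exists>r\<in>rules G (obj_type x) a. good r"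
    and "\<And>s a r. s \<in> set_pmf (step_pmf G \<sigma> \<tau> h) \<Longrightarrow> fmlookup s x = Some (a, r) \<Longrightarrow> good r \<Longrightarrow>
      avoid_prob G target \<sigma> \<tau> k (extend_history h s) \<le> 1 - q"
  shows "avoid_prob G target \<sigma> \<tau> (Suc k) h \<le> 1 - p * q"
proof -
  have h: "h \<in> histories G"
    using assms(1) by (simp add: tracked_def)
  have "p \<le> measure_pmf.prob (step_pmf G \<sigma> \<tau> h) {s. \<exists>a r. fmlookup s x = Some (a, r) \<and> good r}"
    using p by (intro prob_step_ge[OF G \<sigma> \<tau> h _ _ assms(5,6)]) auto
  then have "measure_pmf.expectation (step_pmf G \<sigma> \<tau> h)
      (\<lambda>s. avoid_prob G target \<sigma> \<tau> k (extend_history h s)) \<le> 1 - p * q"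
  proof (rule expectation_le_of_prob_ge)
    show "avoid_prob G target \<sigma> \<tau> k (extend_history h s) \<le> 1 - q"
      if "s \<in> set_pmf (step_pmf G \<sigma> \<tau> h)" "s \<in> {s. \<exists>a r. fmlookup s x = Some (a, r) \<and> good r}" for s
      using assms(7)[OF that(1)] that(2) by blast
  qed (use assms(3,4) in \<open>simp_all add: avoid_prob_bounds\<close>)
  then show ?thesis
    using assms(2) by simp
qed

lemma one_minus_power_nonneg: "0 \<le> 1 - p ^ k"
  using p power_le_one[of p k] by simp

lemma avoid_prob_side:
  assumes "tracked h" "x \<in> population h" "x \<noteq> main_obj F h" "obj_type x \<in> D j"
  shows "avoid_prob G target \<sigma> \<tau> j h \<le> 1 - p ^ j"
  using assms
proof (induction j arbitrary: h x)
  case 0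
  then have "\<not> safe target h"
    by (auto simp: D_0 safe_def)
  then show ?case by simp
next
  case (Suc j)
  show ?case
  proof (cases "safe target h")
    case False
    then show ?thesis
      using one_minus_power_nonneg avoid_prob_unsafe by metis
  next
    case True
    have "avoid_prob G target \<sigma> \<tau> (Suc j) h \<le> 1 - p * p ^ j"
    proof (rule avoid_prob_Suc_le[OF Suc.prems(1) True _ _ Suc.prems(2)])
      fix m a assume m: "m \<in> legal_choices \<sigma> \<tau> h" "fmlookup m x = Some a"
      have h: "h \<in> histories G" using Suc.prems(1) by (simp add: tracked_def)
      show "\<exists>r\<in>rules G (obj_type x) a. \<exists>T'\<in>D j. 0 < snd r T'"
        using legal_\<tau>[OF h Suc.prems(2) m] Suc.prems(2-4) True
        by (intro D_Suc) (auto simp: safe_def)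
    next
      fix s a r assume s: "s \<in> set_pmf (step_pmf G \<sigma> \<tau> h)" "fmlookup s x = Some (a, r)"
        "\<exists>T'\<in>D j. 0 < snd r T'"
      then obtain T' where T': "T' \<in> D j" "0 < snd r T'" by auto
      show "avoid_prob G target \<sigma> \<tau> j (extend_history h s) \<le> 1 - p ^ j"
      proof (rule Suc.IH)
        show "(T', 0) # x \<noteq> main_obj F (extend_history h s)"
          using tracked_extend(2)[OF Suc.prems(1) True s(1)] Suc.prems(3) by (metis list.sel(3))
      qed (use T' tracked_extend(1)[OF Suc.prems(1) True s(1)] child_in_offspring[OF s(2)]
          in \<open>auto simp: obj_type_def\<close>)
    qed (use p in \<open>auto simp: power_le_one\<close>)
    then show ?thesis by simp
  qed
qed

lemma avoid_prob_main:
  assumes "tracked h" "obj_type (main_obj F h) \<in> R i"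
  shows "avoid_prob G target \<sigma> \<tau> (i + N) h \<le> 1 - p ^ (i + N)"
  using assms
proof (induction i arbitrary: h)
  case 0
  then have "\<not> safe target h"
    by (auto simp: R_0 safe_def tracked_def)
  then show ?case
    using one_minus_power_nonneg avoid_prob_unsafe by metis
next
  case (Suc i)
  let ?x = "main_obj F h"
  show ?case
  proof (cases "safe target h")
    case False
    then show ?thesis
      using one_minus_power_nonneg avoid_prob_unsafe by metis
  next
    case True
    have h: "h \<in> histories G" and x: "?x \<in> population h"
      using Suc.prems(1) by (simp_all add: tracked_def)
    have "avoid_prob G target \<sigma> \<tau> (Suc (i + N)) h \<le> 1 - p * p ^ (i + N)"
    proof (rule avoid_prob_Suc_le[OF Suc.prems(1) True _ _ x])
      fix m a assume m: "m \<in> legal_choices \<sigma> \<tau> h" "fmlookup m ?x = Some a"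
      show "\<exists>r\<in>rules G (obj_type ?x) a. 2 \<le> (\<Sum>T'\<in>D N. snd r T') \<or> (\<exists>T'\<in>R i. 0 < snd r T')"
        using legal_\<tau>[OF h x m] Suc.prems(2) x True
        by (intro R_Suc) (auto simp: safe_def)
    next
      fix s a r assume s: "s \<in> set_pmf (step_pmf G \<sigma> \<tau> h)" "fmlookup s ?x = Some (a, r)"
        and good: "2 \<le> (\<Sum>T'\<in>D N. snd r T') \<or> (\<exists>T'\<in>R i. 0 < snd r T')"
      let ?y = "main_obj F (extend_history h s)"
      note tr = tracked_extend[OF Suc.prems(1) True s(1)]
      have side: "avoid_prob G target \<sigma> \<tau> (i + N) (extend_history h s) \<le> 1 - p ^ (i + N)"
        if z: "z \<in> offspring s" "z \<noteq> ?y" "obj_type z \<in> D N" for z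
      proof -
        have "avoid_prob G target \<sigma> \<tau> (i + N) (extend_history h s) \<le> avoid_prob G target \<sigma> \<tau> N (extend_history h s)"
          by (rule avoid_prob_antimono) simp
        also have "\<dots> \<le> 1 - p ^ N"
          using z by (intro avoid_prob_side[OF tr(1)]) auto
        also have "\<dots> \<le> 1 - p ^ (i + N)"
          using p by (simp add: power_decreasing)
        finally show ?thesis .
      qed
      show "avoid_prob G target \<sigma> \<tau> (i + N) (extend_history h s) \<le> 1 - p ^ (i + N)"
        using good
      proof
        assume "\<exists>T'\<in>R i. 0 < snd r T'"
        then obtain T' where T': "T' \<in> R i" "0 < snd r T'" by auto
        let ?z = "(T', 0) # ?x"
        have z: "?z \<in> offspring s" "obj_type ?z = T'"
          using child_in_offspring[OF s(2)] T' by (auto simp: obj_type_def)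
        show ?thesis
        proof (cases "?z = ?y")
          case True
          with z T' show ?thesis
            by (intro Suc.IH[OF tr(1)]) simp
        next
          case False
          with z T' R_le_D[of i] show ?thesis
            by (intro side[of ?z]) auto
        qed
      next
        assume two: "2 \<le> (\<Sum>T'\<in>D N. snd r T')"
        have "\<exists>T' j. T' \<in> D N \<and> j < snd r T' \<and> (T', j) # ?x \<noteq> ?y"
        proof (rule ccontr)
          assume no: "\<not> ?thesis"
          have "card (SIGMA T':D N. {..<snd r T'}) \<le> card {hd ?y}"
            using no by (intro card_mono) (auto, metis list.sel(1))
          with two show False by (simp add: card_SigmaI)
        qed
        then obtain T' j where "T' \<in> D N" "j < snd r T'" "(T', j) # ?x \<noteq> ?y" by blast
        then show ?thesis
          using child_in_offspring[OF s(2)] by (intro side[of "(T', j) # ?x"]) (auto simp: obj_type_def)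
      qed
    qed (use p in \<open>auto simp: power_le_one\<close>)
    then show ?thesis by simp
  qed
qed

lemma avoid_prob_contraction:
  assumes "tracked h"
  shows "avoid_prob G target \<sigma> \<tau> (j + (M + N)) h \<le>
    (1 - p ^ (M + N)) * avoid_prob G target \<sigma> \<tau> j h"
  using assms
proof (induction j arbitrary: h)
  case 0
  show ?case
  proof (cases "safe target h")
    case True
    then show ?thesis
      using avoid_prob_main[of h M] 0 F_le_R by (auto simp: tracked_def)
  qed (simp add: avoid_prob_unsafe)
next
  case (Suc j)
  show ?case
  proof (cases "safe target h")
    case True
    have le: "(1 - p ^ (M + N)) * avoid_prob G target \<sigma> \<tau> j h' \<le> 1" for h'
      using mult_mono[of "1 - p ^ (M + N)" 1 "avoid_prob G target \<sigma> \<tau> j h'" 1]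
        avoid_prob_bounds[of G target \<sigma> \<tau> j h'] p by simp
    have "avoid_prob G target \<sigma> \<tau> (Suc j + (M + N)) h = measure_pmf.expectation (step_pmf G \<sigma> \<tau> h)
        (\<lambda>s. avoid_prob G target \<sigma> \<tau> (j + (M + N)) (extend_history h s))"
      using True by simp
    also have "\<dots> \<le> measure_pmf.expectation (step_pmf G \<sigma> \<tau> h)
        (\<lambda>s. (1 - p ^ (M + N)) * avoid_prob G target \<sigma> \<tau> j (extend_history h s))"
      by (intro expectation_pmf_mono[where B = 1] Suc.IH tracked_extend[OF Suc.prems True]
          avoid_prob_bounds le)
    also have "\<dots> = (1 - p ^ (M + N)) * avoid_prob G target \<sigma> \<tau> (Suc j) h"
      using True by simp
    finally show ?thesis .
  qed (simp add: avoid_prob_unsafe)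
qed

lemma avoid_prob_geometric:
  assumes "tracked h"
  shows "avoid_prob G target \<sigma> \<tau> (k * (M + N)) h \<le> (1 - p ^ (M + N)) ^ k"
proof (induction k)
  case 0
  show ?case by (simp add: avoid_prob_bounds del: avoid_prob.simps)
next
  case (Suc k)
  have "avoid_prob G target \<sigma> \<tau> (Suc k * (M + N)) h \<le>
      (1 - p ^ (M + N)) * avoid_prob G target \<sigma> \<tau> (k * (M + N)) h"
    using avoid_prob_contraction[OF assms, of "k * (M + N)"] by (simp add: add.commute)
  also have "\<dots> \<le> (1 - p ^ (M + N)) * (1 - p ^ (M + N)) ^ k"
    using Suc one_minus_power_nonneg by (intro mult_left_mono)
  finally show ?case by simp
qed

end

theorem theorem9p3:
  fixes G :: "('t::finite, 'a::countable) bssg" and target T :: 't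
  assumes "bssg G"
    and "nonreach_value G target T = 0"
  shows "\<exists>\<tau>\<in>strategies G MinPlayer. deterministic G \<tau> \<and>
           (\<forall>\<sigma>\<in>strategies G MaxPlayer. nonreach_prob G target (singleton_pop T) \<sigma> \<tau> = 0)"
proof -
  let ?g = "game_value G target"
  note sub = subinvariant_game_value[OF assms(1), of target]
  have T: "?g T = 0"
    using game_value_le_nonreach_value[OF assms(1), of target T] assms(2) subinvariantD(1)[OF sub, of T]
    by simp
  let ?D = "attractor G target (can_reach G)"
  obtain N where N: "\<And>n. ?D n \<subseteq> ?D N"
    using attractor_stable[of G target "can_reach G"] by blast
  have D: "?g T = 1" if "T \<notin> ?D N" for T
    using game_value_outside_attractor[OF assms(1) N that] .
  let ?R = "attractor G target (can_branch G target (?D N))"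
  obtain M where M: "\<And>n. ?R n \<subseteq> ?R M"
    using attractor_stable[of G target "can_branch G target (?D N)"] by blast
  let ?F = "{T. ?g T = 0}"
  have F_le_R: "?F \<subseteq> ?R M"
    using value_zero_subset_branch_attractor[OF assms(1) D M] by auto
  have R_le_F: "?R n \<subseteq> ?F" for n
  proof (induction n)
    case 0
    show ?case using subinvariantD(3)[OF sub] by simp
  next
    case (Suc n)
    have "?g T = 0" if "if owner G T = MaxPlayer then \<forall>a\<in>actions G T. can_branch G target (?D N) T a X
        else \<exists>a\<in>actions G T. can_branch G target (?D N) T a X" for T X
      using that bssgD(2)[OF assms(1), of T] unfolding can_branch_def by (auto split: if_splits)
    with Suc show ?case unfolding attractor.simps(2) by blast
  qed
  obtain d where d: "\<And>T. d T \<in> actions G T"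
    "\<And>n T a. T \<in> ?D (Suc n) \<Longrightarrow> T \<noteq> target \<Longrightarrow> a \<in> actions G T \<Longrightarrow>
      owner G T = MaxPlayer \<or> a = d T \<Longrightarrow> can_reach G T a (?D n)"
    by (rule attractor_choice[OF assms(1), of "can_reach G" target], erule (1) can_reach_mono) blast
  obtain f where f: "\<And>T. f T \<in> actions G T"
    "\<And>n T a. T \<in> ?R (Suc n) \<Longrightarrow> T \<noteq> target \<Longrightarrow> a \<in> actions G T \<Longrightarrow>
      owner G T = MaxPlayer \<or> a = f T \<Longrightarrow> can_branch G target (?D N) T a (?R n)"
    by (rule attractor_choice[OF assms(1), of "can_branch G target (?D N)" target],
        erule (1) can_branch_mono) blast
  obtain p where p: "0 < p" "p \<le> 1"
    "\<And>T a r. a \<in> actions G T \<Longrightarrow> r \<in> rules G T a \<Longrightarrow> p \<le> real_of_rat (fst r)"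
    using min_rule_prob[OF assms(1)] by metis
  have child: "\<exists>T'\<in>?F. 0 < snd r T'"
    if "T \<in> ?F" "T \<noteq> target" "a \<in> actions G T" "owner G T = MaxPlayer \<or> a = f T" "r \<in> rules G T a" for T a r
  proof -
    have "T \<in> ?R (Suc M)"
      using that(1) F_le_R by auto
    from f(2)[OF this that(2-4)] have "offspring_value G ?g T a = 0"
      by (simp only: can_branch_def)
    then show ?thesis
      using offspring_value_eq_0[OF assms(1) that(3) subinvariantD(1)[OF sub] _ that(5)] by auto
  qed
  have play: "main_play G target ?F f d ?D ?R N M p \<sigma>" if "\<sigma> \<in> strategies G MaxPlayer" for \<sigma>
  proof
    show "?R n \<subseteq> ?D N" for n
      using R_le_F[of n] D by force
    show "\<exists>r\<in>rules G T a. \<exists>T'\<in>?D n. 0 < snd r T'"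
      if "T \<in> ?D (Suc n)" "T \<noteq> target" "a \<in> actions G T" "owner G T = MaxPlayer \<or> a = d T" for n T a
      using d(2)[OF that] by (simp add: can_reach_def)
    show "\<exists>r\<in>rules G T a. 2 \<le> (\<Sum>T'\<in>?D N. snd r T') \<or> (\<exists>T'\<in>?R n. 0 < snd r T')"
      if "T \<in> ?R (Suc n)" "T \<noteq> target" "a \<in> actions G T" "owner G T = MaxPlayer \<or> a = f T" for n T a
      using f(2)[OF that] by (simp add: can_branch_def)
  qed (fact assms that f(1) d(1) child F_le_R p attractor.simps(1))+
  define \<tau>' where "\<tau>' = choice_strategy G MinPlayer
     (\<lambda>h x. if x = main_obj ?F h then f (obj_type x) else d (obj_type x))"
  have "nonreach_prob G target (singleton_pop T) \<sigma> \<tau>' = 0" if \<sigma>: "\<sigma> \<in> strategies G MaxPlayer" for \<sigma>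
  proof -
    interpret main_play G target ?F f d ?D ?R N M p \<sigma>
      by (rule play[OF \<sigma>])
    have "\<tau>' = \<tau>"
      by (simp add: \<tau>'_def \<tau>_def)
    let ?h = "(singleton_pop T, []) :: ('t, 'a) history"
    have "main_obj ?F ?h = [(T, 0)]"
      using T by (auto simp: main_obj_def roots_singleton_pop obj_type_def intro!: some_equality)
    then have tr: "tracked ?h"
      using T by (simp add: tracked_def histories.init population_def roots_singleton_pop obj_type_def)
    have "nonreach_prob G target (singleton_pop T) \<sigma> \<tau> \<le> (1 - p ^ (M + N)) ^ k" for k
    proof -
      have "nonreach_prob G target (singleton_pop T) \<sigma> \<tau> \<le> avoid_prob G target \<sigma> \<tau> (k * (M + N)) ?h"
        by (rule LIMSEQ_le_const2[OF nonreach_prob_limit]) (auto intro!: avoid_prob_antimono)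
      also have "\<dots> \<le> (1 - p ^ (M + N)) ^ k"
        by (rule avoid_prob_geometric[OF tr])
      finally show ?thesis .
    qed
    moreover have "(\<lambda>k. (1 - p ^ (M + N)) ^ k) \<longlonglongrightarrow> 0"
      using p(1) one_minus_power_nonneg by (intro LIMSEQ_realpow_zero) auto
    ultimately have "nonreach_prob G target (singleton_pop T) \<sigma> \<tau> \<le> 0"
      by (intro LIMSEQ_le_const) auto
    then show ?thesis
      using nonreach_prob_bounds(1)[of G target "singleton_pop T" \<sigma> \<tau>] \<open>\<tau>' = \<tau>\<close> by simp
  qed
  moreover have "\<tau>' \<in> strategies G MinPlayer"
    unfolding \<tau>'_def by (rule choice_strategy_in_strategies) (auto simp: f(1) d(1))
  moreover have "deterministic G \<tau>'"
    unfolding \<tau>'_def by (rule deterministic_choice_strategy)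
  ultimately show ?thesis by blast
qed

end
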